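(* Let $T=[t_{ij}]\in\mathbb{R}^{n\times n}$ be the transition matrix of an $n$-state ergodic homogeneous Markov chain with states $1,\ldots,n$. Let $\Gamma$ be the weighted digraph without loops whose vertices are $1,\ldots,n$ and whose arc weights are equal to the corresponding transition probabilities in $T$. Then for all $i,j\in\{1,\ldots,n\}$ the hitting time $\widehat m_{ij}$ from state $i$ to state $j$ in this chain is given by $$ \widehat m_{ij}=q_j^{-1}\cdot \begin{cases} f_{ij},&\text{if } i\ne j,\\ q,&\text{if } i=j, \end{cases} $$ where $f_{ij}$ is the total weight of 2-tree in-forests of $\Gamma$ that have one tree containing $i$ and the other tree converging to $j$, $q_j$ is the total weight of spanning trees of $\Gamma$ converging to $j$, and $q=\sum_{k=1}^n q_k$ is the total weight of all spanning converging trees in $\Gamma$.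
   Context: The Markov chain $(X_p)_{p\ge 0}$ is ergodic in the sense that its transition matrix $T$ is an irreducible stochastic matrix. The hitting time (mean first passage time) from $i$ to $j$ is $\widehat m_{ij}=\mathrm{E}(F_{ij})=\sum_{k=1}^{\infty}k\Pr(F_{ij}=k)$, where $F_{ij}=\min\{p>0: X_p=j\mid X_0=i\}$ (note $p>0$, so $\widehat m_{ii}$ is the mean return time). The digraph $\Gamma$ has vertex set $\{1,\ldots,n\}$ and has an arc $(i,j)$ with $i\neq j$ whenever $t_{ij}\ne 0$; the weight of this arc is $t_{ij}$. There are no loops. A converging tree is a weakly connected digraph in which one vertex, called the root, has outdegree zero and all the remaining vertices have outdegree one; the tree is said to converge to its root. An in-forest of $\Gamma$ is a spanning subdigraph of $\Gamma$ (i.e. containing all vertices) all of whose weak components are converging trees. A 2-tree in-forest is an in-forest with exactly two weak components. A spanning tree converging to $j$ is an in-forest with exactly one weak component, whose root is $j$. The weight of a weighted digraph is the product of its arc weights (equal to $1$ if it has no arcs); the total weight of a set of digraphs is the sum of the weights of its members ($0$ for the empty set). *)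

theory Defs
  imports "HOL-Probability.Probability" "Graph_Theory.Graph_Theory"
begin

section \<open>Irreducible stochastic matrices\<close>

definition stochastic_matrix :: "real ^ 'n ^ 'n \<Rightarrow> bool" where
  "stochastic_matrix T \<longleftrightarrow> (\<forall>i j. 0 \<le> T $ i $ j) \<and> (\<forall>i. (\<Sum>j\<in>UNIV. T $ i $ j) = 1)"

text \<open>On \<^typ>\<open>real ^ 'n ^ 'n\<close> the operations \<open>*\<close> and \<open>^\<close> act entrywise; matrix multiplication is
  \<open>**\<close>.\<close>

definition matrix_power :: "real ^ 'n ^ 'n \<Rightarrow> nat \<Rightarrow> real ^ 'n ^ 'n" where
  "matrix_power A p = ((\<lambda>B. A ** B) ^^ p) (mat 1)"

text \<open>The usual definition for entrywise nonnegative matrices.\<close>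

definition irreducible_matrix :: "real ^ 'n ^ 'n \<Rightarrow> bool" where
  "irreducible_matrix A \<longleftrightarrow> (\<forall>i j. \<exists>p. 0 < matrix_power A p $ i $ j)"

section \<open>Homogeneous Markov chains and hitting times\<close>

text \<open>The Markov property is required only for histories of positive probability.\<close>

definition markov_chain :: "'a measure \<Rightarrow> (nat \<Rightarrow> 'a \<Rightarrow> 'n::finite) \<Rightarrow> real ^ 'n ^ 'n \<Rightarrow> bool" where
  "markov_chain M X T \<longleftrightarrow>
     prob_space M \<and>
     (\<forall>p. X p \<in> measurable M (count_space UNIV)) \<and>
     (\<forall>p x j. \<P>(\<omega> in M. \<forall>k\<le>p. X k \<omega> = x k) > 0 \<longrightarrow>
        \<P>(\<omega> in M. X (Suc p) \<omega> = j \<bar> \<forall>k\<le>p. X k \<omega> = x k) = T $ x p $ j)"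

text \<open>The value is \<open>\<infinity>\<close> if the state \<open>j\<close> is never visited at a positive time.\<close>

definition first_passage :: "(nat \<Rightarrow> 'a \<Rightarrow> 'n) \<Rightarrow> 'n \<Rightarrow> 'a \<Rightarrow> enat" where
  "first_passage X j \<omega> = (INF p\<in>{p. p > 0 \<and> X p \<omega> = j}. enat p)"

text \<open>\<^term>\<open>uniform_measure M A\<close> is \<^term>\<open>M\<close> conditioned on the event \<^term>\<open>A\<close>, so this is
  \<open>E(F | X\<^sub>0 = i)\<close> with \<open>F\<close> the first passage time to \<open>j\<close>.\<close>

definition hitting_time :: "'a measure \<Rightarrow> (nat \<Rightarrow> 'a \<Rightarrow> 'n) \<Rightarrow> 'n \<Rightarrow> 'n \<Rightarrow> ennreal" where
  "hitting_time M X i j =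
     (\<integral>\<^sup>+\<omega>. ennreal_of_enat (first_passage X j \<omega>) \<partial>uniform_measure M {\<omega> \<in> space M. X 0 \<omega> = i})"

lemma first_passage_eq_enat_iff:
  "first_passage X j \<omega> = enat k \<longleftrightarrow>
     0 < k \<and> X k \<omega> = j \<and> (\<forall>l. 0 < l \<and> l < k \<longrightarrow> X l \<omega> \<noteq> j)"
proof (cases "\<exists>p>0. X p \<omega> = j")
  case True
  define m where "m = (LEAST p. p > 0 \<and> X p \<omega> = j)"
  have m: "m > 0 \<and> X m \<omega> = j"
    unfolding m_def using True by (rule LeastI_ex)
  have least: "m \<le> l" if "l > 0" "X l \<omega> = j" for l
    unfolding m_def using that by (intro Least_le) auto
  have "first_passage X j \<omega> = enat m"
    unfolding first_passage_def using m least by (intro antisym INF_lower INF_greatest) auto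
  moreover have "m = k \<longleftrightarrow> 0 < k \<and> X k \<omega> = j \<and> (\<forall>l. 0 < l \<and> l < k \<longrightarrow> X l \<omega> \<noteq> j)"
    using m least by (metis leD nat_neq_iff)
  ultimately show ?thesis by simp
next
  case False
  then have "{p. p > 0 \<and> X p \<omega> = j} = {}" by auto
  then have "first_passage X j \<omega> = \<infinity>"
    by (simp add: first_passage_def top_enat_def[symmetric] del: Collect_empty_eq)
  then show ?thesis using False by auto
qed

text \<open>The expectation is the series \<open>\<Sum>k\<ge>1. k Pr(F = k | X\<^sub>0 = i)\<close>, as long as \<open>j\<close> is hit
  almost surely; otherwise it is infinite.\<close>

lemma hitting_time_eq_series:
  assumes chain: "markov_chain M X T" and pos: "\<P>(\<omega> in M. X 0 \<omega> = i) > 0"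
  shows "hitting_time M X i j =
    (\<Sum>k. of_nat k * ennreal \<P>(\<omega> in M. first_passage X j \<omega> = enat k \<bar> X 0 \<omega> = i)) +
    \<infinity> * ennreal \<P>(\<omega> in M. first_passage X j \<omega> = \<infinity> \<bar> X 0 \<omega> = i)"
proof -
  interpret prob_space M using chain by (simp add: markov_chain_def)
  have [measurable]: "X p \<in> measurable M (count_space UNIV)" for p
    using chain by (simp add: markov_chain_def)
  define F where "F = first_passage X j"
  define A where "A = {\<omega> \<in> space M. X 0 \<omega> = i}"
  define N where "N = uniform_measure M A"
  have [measurable]: "A \<in> sets M" unfolding A_def by measurable
  have [simp]: "space N = space M" "sets N = sets M" by (simp_all add: N_def)
  have fin[measurable]: "{\<omega> \<in> space M. F \<omega> = enat k} \<in> sets M" for k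
    unfolding F_def first_passage_eq_enat_iff by measurable
  have "{\<omega> \<in> space M. F \<omega> = \<infinity>} = space M - (\<Union>k. {\<omega> \<in> space M. F \<omega> = enat k})"
    by (auto simp: not_infinity_eq)
  then have inf[measurable]: "{\<omega> \<in> space M. F \<omega> = \<infinity>} \<in> sets M" by simp
  have prob: "emeasure N {\<omega> \<in> space M. F \<omega> = y} = ennreal \<P>(\<omega> in M. F \<omega> = y \<bar> X 0 \<omega> = i)" for y
  proof -
    have meas: "{\<omega> \<in> space M. F \<omega> = y} \<in> sets M" by (cases y) (auto intro: fin inf)
    have A0: "measure M A > 0" using pos by (simp add: A_def)
    then have "emeasure M A \<noteq> 0" by (simp add: emeasure_eq_measure)
    then interpret N: prob_space N
      unfolding N_def by (intro prob_space_uniform_measure) auto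
    have "A \<inter> {\<omega> \<in> space M. F \<omega> = y} = {\<omega> \<in> space M. F \<omega> = y \<and> X 0 \<omega> = i}"
      by (auto simp: A_def)
    then have "measure N {\<omega> \<in> space M. F \<omega> = y} = \<P>(\<omega> in M. F \<omega> = y \<bar> X 0 \<omega> = i)"
      using meas A0 unfolding N_def
      by (subst measure_uniform_measure) (auto simp: emeasure_eq_measure cond_prob_def A_def)
    then show ?thesis by (simp add: N.emeasure_eq_measure)
  qed
  have pt: "ennreal_of_enat (F \<omega>) =
      (\<Sum>k. of_nat k * indicator {\<omega> \<in> space M. F \<omega> = enat k} \<omega>) +
      \<infinity> * indicator {\<omega> \<in> space M. F \<omega> = \<infinity>} \<omega>" if "\<omega> \<in> space M" for \<omega>
  proof (cases "F \<omega>")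
    case (enat m)
    have "(\<Sum>k. of_nat k * indicator {\<omega> \<in> space M. F \<omega> = enat k} \<omega>) =
        (\<Sum>k\<in>{m}. of_nat k * indicator {\<omega> \<in> space M. F \<omega> = enat k} \<omega> :: ennreal)"
      by (intro suminf_finite) (auto simp: enat)
    then show ?thesis using that enat by simp
  next
    case infinity
    then show ?thesis using that by simp
  qed
  have "hitting_time M X i j = (\<integral>\<^sup>+\<omega>. ennreal_of_enat (F \<omega>) \<partial>N)"
    by (simp add: hitting_time_def N_def A_def F_def)
  also have "\<dots> = (\<integral>\<^sup>+\<omega>. ((\<Sum>k. of_nat k * indicator {\<omega> \<in> space M. F \<omega> = enat k} \<omega>) +
      \<infinity> * indicator {\<omega> \<in> space M. F \<omega> = \<infinity>} \<omega>) \<partial>N)"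
    by (intro nn_integral_cong pt) simp
  also have "\<dots> = (\<integral>\<^sup>+\<omega>. (\<Sum>k. of_nat k * indicator {\<omega> \<in> space M. F \<omega> = enat k} \<omega>) \<partial>N) +
      (\<integral>\<^sup>+\<omega>. \<infinity> * indicator {\<omega> \<in> space M. F \<omega> = \<infinity>} \<omega> \<partial>N)"
    by (intro nn_integral_add) (auto simp: N_def)
  also have "(\<integral>\<^sup>+\<omega>. (\<Sum>k. of_nat k * indicator {\<omega> \<in> space M. F \<omega> = enat k} \<omega>) \<partial>N) =
      (\<Sum>k. of_nat k * emeasure N {\<omega> \<in> space M. F \<omega> = enat k})"
    by (subst nn_integral_suminf) (auto simp: N_def nn_integral_cmult_indicator)
  also have "(\<integral>\<^sup>+\<omega>. \<infinity> * indicator {\<omega> \<in> space M. F \<omega> = \<infinity>} \<omega> \<partial>N) =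
      \<infinity> * emeasure N {\<omega> \<in> space M. F \<omega> = \<infinity>}"
    by (intro nn_integral_cmult_indicator) simp
  finally show ?thesis by (simp only: prob) (simp only: F_def)
qed

text \<open>A chain with any given transition matrix and a positive probability of starting in every state
  exists: let independent random maps act on a uniformly distributed initial state.\<close>

lemma markov_chain_exists:
  fixes T :: "real ^ 'n::finite ^ 'n::finite"
  assumes "stochastic_matrix T"
  shows "\<exists>(M :: (nat \<Rightarrow> 'n \<Rightarrow> 'n) measure) X.
           markov_chain M X T \<and> (\<forall>i. \<P>(\<omega> in M. X 0 \<omega> = i) > 0)"
proof -
  define row where "row a = embed_pmf (\<lambda>b. T $ a $ b)" for a
  have row: "pmf (row a) b = T $ a $ b" for a b
    unfolding row_def using assms
    by (intro pmf_embed_pmf)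
      (auto simp: stochastic_matrix_def nn_integral_count_space_finite sum_ennreal)
  define \<mu> where "\<mu> p = (if p = 0 then map_pmf (\<lambda>a _. a) (pmf_of_set UNIV)
      else Pi_pmf UNIV undefined row)" for p :: nat
  define M where "M = PiM (UNIV::nat set) (\<lambda>p. measure_pmf (\<mu> p))"
  define X where "X = rec_nat (\<lambda>\<omega> :: nat \<Rightarrow> 'n \<Rightarrow> 'n. \<omega> 0 undefined) (\<lambda>p x \<omega>. \<omega> (Suc p) (x \<omega>))"
  have X0: "X 0 \<omega> = \<omega> 0 undefined" and XS: "X (Suc p) \<omega> = \<omega> (Suc p) (X p \<omega>)" for p \<omega>
    by (simp_all add: X_def)
  interpret product_prob_space "\<lambda>p. measure_pmf (\<mu> p)" "UNIV :: nat set"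
    by standard
  interpret MM: prob_space M unfolding M_def by (rule prob_space_PiM) (rule measure_pmf.prob_space_axioms)
  define B where "B x p = (if p = 0 then {f :: 'n \<Rightarrow> 'n. f undefined = x 0}
      else {f. f (x (p - 1)) = x p})" for x :: "nat \<Rightarrow> 'n" and p :: nat
  have hist: "(\<forall>k\<le>p. X k \<omega> = x k) \<longleftrightarrow> (\<forall>k\<le>p. \<omega> k \<in> B x k)" for p x \<omega>
  proof (induction p)
    case 0
    show ?case by (simp add: X0 B_def)
  next
    case (Suc p)
    have "(\<forall>k\<le>Suc p. X k \<omega> = x k) \<longleftrightarrow> (\<forall>k\<le>p. X k \<omega> = x k) \<and> X (Suc p) \<omega> = x (Suc p)"
      by (auto simp: le_Suc_eq)
    also have "\<dots> \<longleftrightarrow> (\<forall>k\<le>p. X k \<omega> = x k) \<and> \<omega> (Suc p) (x p) = x (Suc p)"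
      by (auto simp: XS)
    also have "\<dots> \<longleftrightarrow> (\<forall>k\<le>Suc p. \<omega> k \<in> B x k)"
      unfolding Suc.IH by (auto simp: le_Suc_eq B_def)
    finally show ?case .
  qed
  have P: "\<P>(\<omega> in M. \<forall>k\<le>p. X k \<omega> = x k) = (\<Prod>k\<le>p. measure_pmf.prob (\<mu> k) (B x k))" for p x
  proof -
    have "{\<omega> \<in> space M. \<forall>k\<le>p. X k \<omega> = x k} = prod_emb UNIV (\<lambda>p. measure_pmf (\<mu> p)) {..p} (Pi\<^sub>E {..p} (B x))"
      unfolding hist by (auto simp: prod_emb_def M_def space_PiM)
    then show ?thesis
      by (simp add: M_def measure_PiM_emb)
  qed
  have 1: "measure_pmf.prob (\<mu> (Suc p)) (B x (Suc p)) = T $ x p $ x (Suc p)" for p x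
  proof -
    have "measure_pmf.prob (\<mu> (Suc p)) (B x (Suc p)) =
        measure_pmf.prob (map_pmf (\<lambda>f. f (x p)) (Pi_pmf UNIV undefined row)) {x (Suc p)}"
      by (simp add: \<mu>_def B_def vimage_def)
    also have "map_pmf (\<lambda>f. f (x p)) (Pi_pmf UNIV undefined row) = row (x p)"
      by (simp add: Pi_pmf_component)
    finally show ?thesis by (simp add: measure_pmf_single row)
  qed
  have meas: "X p \<in> measurable M (count_space UNIV)" for p
  proof (induction p)
    case 0
    have "(\<lambda>\<omega>. \<omega> 0) \<in> measurable M (measure_pmf (\<mu> 0))"
      unfolding M_def by (rule measurable_component_singleton) simp
    then have "(\<lambda>\<omega>. (\<lambda>f. f undefined) (\<omega> 0)) \<in> measurable M (count_space UNIV)"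
      by (rule measurable_compose) simp
    then show ?case by (simp add: X0[abs_def])
  next
    case (Suc p)
    have c: "(\<lambda>\<omega>. \<omega> (Suc p)) \<in> measurable M (measure_pmf (\<mu> (Suc p)))"
      unfolding M_def by (rule measurable_component_singleton) simp
    have "(\<lambda>\<omega>. \<omega> (Suc p) a) \<in> measurable M (count_space UNIV)" for a
      by (rule measurable_compose[OF c]) simp
    then have "(\<lambda>\<omega>. \<omega> (Suc p) (X p \<omega>)) \<in> measurable M (count_space UNIV)"
      using Suc by (rule measurable_compose_countable)
    then show ?case by (simp add: XS[abs_def])
  qed
  have "markov_chain M X T"
    unfolding markov_chain_def
  proof (intro conjI allI impI)
    show "prob_space M" by (rule MM.prob_space_axioms)
    show "X p \<in> measurable M (count_space UNIV)" for p by (rule meas)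
  next
    fix p x j
    assume pos: "\<P>(\<omega> in M. \<forall>k\<le>p. X k \<omega> = x k) > 0"
    define y where "y = x(Suc p := j)"
    have "X (Suc p) \<omega> = j \<and> (\<forall>k\<le>p. X k \<omega> = x k) \<longleftrightarrow> (\<forall>k\<le>Suc p. X k \<omega> = y k)" for \<omega>
      by (auto simp: y_def le_Suc_eq)
    then have "\<P>(\<omega> in M. X (Suc p) \<omega> = j \<and> (\<forall>k\<le>p. X k \<omega> = x k)) =
        (\<Prod>k\<le>p. measure_pmf.prob (\<mu> k) (B y k)) * T $ x p $ j"
      by (simp add: P 1) (simp add: y_def)
    also have "(\<Prod>k\<le>p. measure_pmf.prob (\<mu> k) (B y k)) = (\<Prod>k\<le>p. measure_pmf.prob (\<mu> k) (B x k))"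
      by (intro prod.cong refl) (auto simp: B_def y_def)
    finally show "\<P>(\<omega> in M. X (Suc p) \<omega> = j \<bar> \<forall>k\<le>p. X k \<omega> = x k) = T $ x p $ j"
      using pos by (simp add: cond_prob_def flip: P)
  qed
  moreover have "\<P>(\<omega> in M. X 0 \<omega> = i) > 0" for i
  proof -
    have "\<P>(\<omega> in M. X 0 \<omega> = i) = measure_pmf.prob (\<mu> 0) (B (\<lambda>_. i) 0)"
      using P[of 0 "\<lambda>_. i"] by simp
    also have "\<dots> = measure_pmf.prob (pmf_of_set UNIV) {i}"
      by (simp add: \<mu>_def B_def vimage_def)
    finally show ?thesis by (simp add: measure_pmf_single)
  qed
  ultimately show ?thesis by blast
qed

section \<open>In-forests\<close>

text \<open>The library's \<^const>\<open>connected\<close> is connectedness of the underlying undirected graph.\<close>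

definition weak_components :: "('a, 'b) pre_digraph \<Rightarrow> ('a, 'b) pre_digraph set" where
  "weak_components G = {C. pre_digraph.max_subgraph G connected C}"

definition converging_tree :: "('a, 'b) pre_digraph \<Rightarrow> 'a \<Rightarrow> bool" where
  "converging_tree G r \<longleftrightarrow>
     connected G \<and> r \<in> verts G \<and> out_degree G r = 0 \<and> (\<forall>v\<in>verts G - {r}. out_degree G v = 1)"

definition in_forest :: "('a, 'b) pre_digraph \<Rightarrow> ('a, 'b) pre_digraph \<Rightarrow> bool" where
  "in_forest F G \<longleftrightarrow> spanning F G \<and> (\<forall>C\<in>weak_components F. \<exists>r. converging_tree C r)"

definition spanning_converging_trees ::
    "('a, 'b) pre_digraph \<Rightarrow> 'a \<Rightarrow> ('a, 'b) pre_digraph set" where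
  "spanning_converging_trees G j =
     {F. in_forest F G \<and> (\<exists>C. weak_components F = {C} \<and> converging_tree C j)}"

definition two_tree_in_forests ::
    "('a, 'b) pre_digraph \<Rightarrow> 'a \<Rightarrow> 'a \<Rightarrow> ('a, 'b) pre_digraph set" where
  "two_tree_in_forests G i j =
     {F. in_forest F G \<and>
         (\<exists>C D. C \<noteq> D \<and> weak_components F = {C, D} \<and> i \<in> verts C \<and> converging_tree D j)}"

definition digraph_weight :: "('b \<Rightarrow> real) \<Rightarrow> ('a, 'b) pre_digraph \<Rightarrow> real" where
  "digraph_weight w F = (\<Prod>a\<in>arcs F. w a)"

definition total_weight :: "('b \<Rightarrow> real) \<Rightarrow> ('a, 'b) pre_digraph set \<Rightarrow> real" where
  "total_weight w S = (\<Sum>F\<in>S. digraph_weight w F)"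

section \<open>The weighted digraph of a chain\<close>

definition chain_digraph :: "real ^ 'n ^ 'n \<Rightarrow> ('n, 'n \<times> 'n) pre_digraph" where
  "chain_digraph T =
     with_proj \<lparr>pverts = UNIV, parcs = {(a, b). a \<noteq> b \<and> T $ a $ b \<noteq> 0}\<rparr>"

definition arc_weight :: "real ^ 'n ^ 'n \<Rightarrow> 'n \<times> 'n \<Rightarrow> real" where
  "arc_weight T = (\<lambda>(a, b). T $ a $ b)"

definition tree_weight :: "real ^ 'n ^ 'n \<Rightarrow> 'n \<Rightarrow> real" where
  "tree_weight T j = total_weight (arc_weight T) (spanning_converging_trees (chain_digraph T) j)"

definition forest_weight :: "real ^ 'n ^ 'n \<Rightarrow> 'n \<Rightarrow> 'n \<Rightarrow> real" where
  "forest_weight T i j = total_weight (arc_weight T) (two_tree_in_forests (chain_digraph T) i j)"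

lemma finite_spanning_converging_trees:
  assumes "finite (arcs G)"
  shows "finite (spanning_converging_trees G j)"
proof (rule finite_subset)
  show "spanning_converging_trees G j \<subseteq>
      (\<lambda>A. \<lparr>verts = verts G, arcs = A, tail = tail G, head = head G\<rparr>) ` Pow (arcs G)"
    by (auto simp: spanning_converging_trees_def in_forest_def spanning_def subgraph_def
        compatible_def image_iff intro!: pre_digraph.equality)
  show "finite ((\<lambda>A. \<lparr>verts = verts G, arcs = A, tail = tail G, head = head G\<rparr>) ` Pow (arcs G))"
    using assms by simp
qed

lemma converging_tree_root_unique:
  "converging_tree G r \<Longrightarrow> converging_tree G s \<Longrightarrow> r = s"
  unfolding converging_tree_def by (metis DiffI singletonD zero_neq_one)

lemma sum_tree_weight:
  "(\<Sum>k\<in>UNIV. tree_weight T k) =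
     total_weight (arc_weight T) (\<Union>k. spanning_converging_trees (chain_digraph T) k)"
  unfolding tree_weight_def total_weight_def
proof (rule sum.UNION_disjoint[symmetric])
  show "\<forall>k\<in>UNIV. finite (spanning_converging_trees (chain_digraph T) k)"
    by (simp add: finite_spanning_converging_trees)
  show "\<forall>k\<in>UNIV. \<forall>l\<in>UNIV. k \<noteq> l \<longrightarrow> spanning_converging_trees (chain_digraph T) k \<inter>
      spanning_converging_trees (chain_digraph T) l = {}"
    by (auto simp: spanning_converging_trees_def dest: converging_tree_root_unique)
qed simp

end

theory Submission
  imports Defs
begin

text \<open>A spanning converging tree, or an in-forest, is the graph of the self-map sending each vertex to its
  successor and each root to itself. Let \<open>q j\<close> and \<open>f i j\<close> be the tree and forest weights. Cutting
  the arc out of \<open>j\<close> in trees with another root gives \<open>q = q j + \<Sum>l. t j l * f l j\<close>; exchanging the arc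
  \<open>i \<rightarrow> l\<close> with the arc out of \<open>i\<close> gives \<open>f i j = q j + \<Sum>l. t i l * f l j\<close> for \<open>i \<noteq> j\<close>. So the quotients
  satisfy the first-step equations \<open>H b = 1 + \<Sum>c\<noteq>j. t b c * H c\<close>. A nonnegative solution of these is
  the hitting time, because summing the survival probabilities \<open>Pr(F > p)\<close> telescopes.\<close>

section \<open>Functional forests\<close>

text \<open>For a fixed point \<open>r\<close>, this is the vertex set of the tree converging to
  \<open>r\<close>; for any other \<open>r\<close> it collects the vertices whose path runs through
  \<open>r\<close>.\<close>

definition basin :: "('a \<Rightarrow> 'a) \<Rightarrow> 'a \<Rightarrow> 'a set" where
  "basin f r = {v. \<exists>k. (f ^^ k) v = r}"

lemma basin_self: "r \<in> basin f r"
  unfolding basin_def by (auto intro: exI[of _ 0])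

lemma basin_step: "f v \<in> basin f r \<Longrightarrow> v \<in> basin f r"
  unfolding basin_def by (auto simp: funpow_swap1 intro: exI[of _ "Suc _"])

lemma basin_trans:
  assumes "v \<in> basin f s" "s \<in> basin f r"
  shows "v \<in> basin f r"
proof -
  from assms obtain k m where "(f ^^ k) v = s" "(f ^^ m) s = r"
    by (auto simp: basin_def)
  then have "(f ^^ (m + k)) v = r" by (simp add: funpow_add)
  then show ?thesis unfolding basin_def by blast
qed

lemma funpow_fixpoint: "f r = r \<Longrightarrow> (f ^^ k) r = r"
  by (induction k) auto

lemma basin_apply:
  assumes "v \<in> basin f r" "f r = r"
  shows "f v \<in> basin f r"
proof -
  from assms obtain k where "(f ^^ k) v = r" by (auto simp: basin_def)
  then have "(f ^^ k) (f v) = r" by (simp flip: funpow_swap1 add: assms(2))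
  then show ?thesis unfolding basin_def by blast
qed

lemma fixpoint_in_basin_iff: "f s = s \<Longrightarrow> s \<in> basin f r \<longleftrightarrow> s = r"
  by (auto simp: basin_def funpow_fixpoint)

text \<open>An orbit stays at a fixed point once it is there, so after \<open>k + m\<close> steps it
  is at both \<open>r\<close> and \<open>s\<close>.\<close>

lemma basin_disjoint:
  assumes "v \<in> basin f r" "v \<in> basin f s" "f r = r" "f s = s"
  shows "r = s"
proof -
  from assms obtain k m where k: "(f ^^ k) v = r" and m: "(f ^^ m) v = s"
    by (auto simp: basin_def)
  have "(f ^^ (m + k)) v = r" using k assms(3) by (simp add: funpow_add funpow_fixpoint)
  moreover have "(f ^^ (k + m)) v = s" using m assms(4) by (simp add: funpow_add funpow_fixpoint)
  ultimately show ?thesis by (simp add: add.commute)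
qed

section \<open>Effect on basins of redirecting a single vertex\<close>

lemma basin_step_update:
  assumes "v \<noteq> i" "f v \<in> basin (f(i := l)) r"
  shows "v \<in> basin (f(i := l)) r"
proof (rule basin_step)
  show "(f(i := l)) v \<in> basin (f(i := l)) r"
    by (subst (1) fun_upd_other) (rule assms)+
qed

text \<open>The old path from \<open>v\<close> to \<open>r\<close> remains valid up to its first
  visit to \<open>i\<close>; either it never visits \<open>i\<close> or it leads there.\<close>

lemma basin_update:
  assumes "v \<in> basin f r"
  shows "v \<in> basin (f(i := l)) r \<or> v \<in> basin (f(i := l)) i"
proof -
  from assms obtain k where "(f ^^ k) v = r" by (auto simp: basin_def)
  then show ?thesis
  proof (induction k arbitrary: v)
    case 0
    then show ?case by (simp add: basin_self)
  next
    case (Suc k)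
    show ?case
    proof (cases "v = i")
      case True
      then show ?thesis by (simp add: basin_self)
    next
      case False
      have "(f ^^ k) (f v) = r" using Suc.prems by (simp add: funpow_swap1)
      from Suc.IH[OF this] show ?thesis
        using basin_step_update[OF False] by blast
    qed
  qed
qed

text \<open>A vertex on the path from \<open>v\<close> to \<open>r\<close> is itself in the basin,
  so the path avoids the redirected vertex.\<close>

lemma basin_update_outside:
  assumes "v \<in> basin f r" "f r = r" "i \<notin> basin f r"
  shows "v \<in> basin (f(i := l)) r"
proof -
  from assms(1) obtain k where "(f ^^ k) v = r" by (auto simp: basin_def)
  then show ?thesis
  proof (induction k arbitrary: v)
    case 0
    then show ?case by (simp add: basin_self)
  next
    case (Suc k)
    then have "v \<noteq> i" using assms(3) unfolding basin_def by blast
    moreover have "(f ^^ k) (f v) = r" using Suc.prems by (simp add: funpow_swap1)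
    ultimately show ?case using Suc.IH[of "f v"] by (blast intro!: basin_step_update[of v i])
  qed
qed

text \<open>Let \<open>d\<close> be the first time at which the orbit of \<open>i\<close> is at
  \<open>r\<close>. The remaining path from \<open>f i\<close> to \<open>r\<close> cannot return to
  \<open>i\<close>, since this would give a shorter way from \<open>i\<close> to \<open>r\<close>;
  hence redirecting \<open>i\<close> leaves that path intact.\<close>

lemma basin_update_apply:
  assumes "i \<in> basin f r" "f r = r" "i \<noteq> r"
  shows "f i \<in> basin (f(i := l)) r"
proof -
  define d where "d = (LEAST k. (f ^^ k) i = r)"
  have d: "(f ^^ d) i = r"
    unfolding d_def by (rule LeastI_ex[where P = "\<lambda>k. (f ^^ k) i = r"]) (use assms(1) in \<open>auto simp: basin_def\<close>)
  have least: "d \<le> k" if "(f ^^ k) i = r" for k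
    unfolding d_def using that by (rule Least_le[where P = "\<lambda>k. (f ^^ k) i = r"])
  obtain e where e: "d = Suc e" using d assms(3) by (cases d) auto
  have "v \<in> basin (f(i := l)) r" if "(f ^^ k) v = r" "k < d" for k v
    using that
  proof (induction k arbitrary: v)
    case 0
    then show ?case by (simp add: basin_self)
  next
    case (Suc k)
    then have "v \<noteq> i" using least[of "Suc k"] by auto
    moreover have "(f ^^ k) (f v) = r" using Suc.prems by (simp add: funpow_swap1)
    ultimately show ?case
      using Suc.IH[of "f v"] Suc.prems(2) by (metis Suc_lessD basin_step_update)
  qed
  moreover have "(f ^^ e) (f i) = r" using d e by (simp add: funpow_swap1)
  ultimately show ?thesis using e by blast
qed

section \<open>Trees and two-tree forests as self-maps, and the surgeries between them\<close>

definition tree_maps :: "'a \<Rightarrow> ('a \<Rightarrow> 'a) set" where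
  "tree_maps j = {f. f j = j \<and> basin f j = UNIV}"

definition forest_maps :: "'a \<Rightarrow> 'a \<Rightarrow> ('a \<Rightarrow> 'a) set" where
  "forest_maps i j =
     {f. f j = j \<and> (\<exists>k. k \<noteq> j \<and> f k = k \<and> i \<in> basin f k \<and> basin f k \<union> basin f j = UNIV)}"

lemma tree_maps_fixpoint: "f \<in> tree_maps j \<Longrightarrow> f v = v \<longleftrightarrow> v = j"
  using fixpoint_in_basin_iff[of f v j] by (auto simp: tree_maps_def)

lemma forest_mapsI:
  assumes "f j = j" "k \<noteq> j" "f k = k" "i \<in> basin f k"
    "\<And>v. v \<in> basin f k \<or> v \<in> basin f j"
  shows "f \<in> forest_maps i j"
  using assms unfolding forest_maps_def by blast

lemma forest_mapsE:
  assumes "f \<in> forest_maps i j"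
  obtains k where "f j = j" "k \<noteq> j" "f k = k" "i \<in> basin f k"
    "\<And>v. v \<in> basin f k \<or> v \<in> basin f j"
  using assms unfolding forest_maps_def by blast

lemma forest_maps_not_in_basin: "f \<in> forest_maps i j \<Longrightarrow> i \<notin> basin f j"
  by (auto elim!: forest_mapsE dest: basin_disjoint)

text \<open>There are only two basins, so a vertex outside that of \<open>j\<close> shares the tree
  of \<open>i\<close>. In the exchange argument this tells which pairs belong to only one of the two
  sums.\<close>

lemma forest_maps_switch:
  assumes "f \<in> forest_maps i j"
  shows "f \<in> forest_maps l j \<longleftrightarrow> l \<notin> basin f j"
proof
  show "f \<in> forest_maps l j \<Longrightarrow> l \<notin> basin f j" by (rule forest_maps_not_in_basin)
  show "f \<in> forest_maps l j" if "l \<notin> basin f j"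
    using assms that unfolding forest_maps_def by blast
qed

lemma forest_maps_self: "forest_maps j j = {}"
  using forest_maps_not_in_basin basin_self by fast

text \<open>The new arc hangs the whole tree of \<open>j\<close> on the vertex \<open>l\<close> of
  the other tree, whose root then absorbs everything.\<close>

lemma forest_maps_link_tree:
  assumes f: "f \<in> forest_maps l j"
  shows "\<exists>k. k \<noteq> j \<and> f(j := l) \<in> tree_maps k"
proof -
  from f obtain k where k: "f j = j" "k \<noteq> j" "f k = k" "l \<in> basin f k"
    "\<And>v. v \<in> basin f k \<or> v \<in> basin f j" by (rule forest_mapsE) blast
  let ?g = "f(j := l)"
  \<comment> \<open>Hence the tree of \<open>k\<close> is untouched by the change at
    \<open>j\<close>.\<close>
  have *: "j \<notin> basin f k" using k fixpoint_in_basin_iff[of f j k] by auto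
  have sub: "v \<in> basin ?g k" if "v \<in> basin f k" for v
    using basin_update_outside[OF that k(3) *] .
  have j: "j \<in> basin ?g k" using basin_step[of ?g j k] sub[OF k(4)] by simp
  have "v \<in> basin ?g k" for v
    using k(5)[of v] sub[of v] basin_update[of v f j j l] basin_trans[OF _ j] by blast
  then show ?thesis using k by (auto simp: tree_maps_def)
qed

text \<open>This reverses the linking: vertices whose path runs through \<open>j\<close> now end
  there, the others still reach \<open>k\<close>. The old successor \<open>g j\<close> is among the
  latter because its path to \<open>k\<close> does not return to \<open>j\<close>.\<close>

lemma tree_maps_cut:
  assumes g: "g \<in> tree_maps k" and "k \<noteq> j"
  shows "g(j := j) \<in> forest_maps (g j) j"
proof (rule forest_mapsI)
  have k: "g k = k" "\<And>v. v \<in> basin g k" using g by (auto simp: tree_maps_def)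
  show "(g(j := j)) j = j" "(g(j := j)) k = k" "k \<noteq> j" using k \<open>k \<noteq> j\<close> by auto
  show "g j \<in> basin (g(j := j)) k"
    using k \<open>k \<noteq> j\<close> by (intro basin_update_apply) auto
  show "v \<in> basin (g(j := j)) k \<or> v \<in> basin (g(j := j)) j" for v
    using basin_update[of v g k j j] k by blast
qed

text \<open>Redirecting \<open>i\<close> to \<open>l\<close> moves \<open>i\<close>, and all
  vertices whose path runs through \<open>i\<close>, into the tree of \<open>j\<close>. If
  \<open>i\<close> was the second root, nothing is left of its tree; otherwise the old root remains,
  together with the old successor \<open>f i\<close>.\<close>

lemma forest_maps_swap_out:
  assumes f: "f \<in> forest_maps i j" and l: "l \<in> basin f j"
  shows "if f i = i then f(i := l) \<in> tree_maps j
         else f(i := l) \<in> forest_maps (f i) j \<and> i \<in> basin (f(i := l)) j"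
proof -
  from f obtain k where k: "f j = j" "k \<noteq> j" "f k = k" "i \<in> basin f k"
    "\<And>v. v \<in> basin f k \<or> v \<in> basin f j" by (rule forest_mapsE) blast
  let ?g = "f(i := l)"
  have i: "i \<notin> basin f j" using f by (rule forest_maps_not_in_basin)
  then have "i \<noteq> j" using basin_self[of j f] by auto
  have sub: "v \<in> basin ?g j" if "v \<in> basin f j" for v
    using basin_update_outside[OF that k(1) i] .
  have ij: "i \<in> basin ?g j" using basin_step[of ?g i j] sub[OF l] by simp
  have or: "v \<in> basin ?g k \<or> v \<in> basin ?g j" for v
    using k(5)[of v] sub[of v] basin_update[of v f k i l] basin_trans[OF _ ij] by blast
  show ?thesis
  proof (cases "f i = i")
    case True
    then have "k = i" using k(4) fixpoint_in_basin_iff by metis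
    then show ?thesis using True or basin_trans[OF _ ij] k(1) \<open>i \<noteq> j\<close>
      by (auto simp: tree_maps_def)
  next
    case False
    then have "i \<noteq> k" using k by auto
    have "f i \<in> basin ?g k" using k(4,3) \<open>i \<noteq> k\<close> by (rule basin_update_apply)
    then have "?g \<in> forest_maps (f i) j"
      using k \<open>i \<noteq> k\<close> \<open>i \<noteq> j\<close> or by (intro forest_mapsI[of _ j k]) auto
    then show ?thesis using False ij by simp
  qed
qed

text \<open>This is the opposite move: \<open>i\<close> and the vertices flowing through it leave
  the tree of \<open>j\<close> for that of \<open>l\<close>, while the old successor
  \<open>f i\<close> stays behind.\<close>

lemma forest_maps_swap_in:
  assumes f: "f \<in> forest_maps l j" and i: "i \<in> basin f j" "i \<noteq> j"
  shows "f(i := l) \<in> forest_maps i j \<and> f i \<in> basin (f(i := l)) j"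
proof -
  from f obtain k where k: "f j = j" "k \<noteq> j" "f k = k" "l \<in> basin f k"
    "\<And>v. v \<in> basin f k \<or> v \<in> basin f j" by (rule forest_mapsE) blast
  let ?g = "f(i := l)"
  have ik: "i \<notin> basin f k" using k(1-3) i(1) basin_disjoint[of i f k j] by auto
  then have "i \<noteq> k" using basin_self[of k f] by auto
  have sub: "v \<in> basin ?g k" if "v \<in> basin f k" for v
    using basin_update_outside[OF that k(3) ik] .
  have gi: "i \<in> basin ?g k" using basin_step[of ?g i k] sub[OF k(4)] by simp
  have or: "v \<in> basin ?g k \<or> v \<in> basin ?g j" for v
    using k(5)[of v] sub[of v] basin_update[of v f j i l] basin_trans[OF _ gi] by blast
  have "?g \<in> forest_maps i j"
    using k \<open>i \<noteq> k\<close> \<open>i \<noteq> j\<close> or gi by (intro forest_mapsI[of _ j k]) auto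
  moreover have "f i \<in> basin ?g j"
    using i k by (intro basin_update_apply) auto
  ultimately show ?thesis by simp
qed

section \<open>Weights\<close>

definition map_weight :: "real ^ 'n ^ 'n \<Rightarrow> ('n::finite \<Rightarrow> 'n) \<Rightarrow> real" where
  "map_weight T f = (\<Prod>v | f v \<noteq> v. T $ v $ f v)"

lemma map_weight_split:
  "map_weight T f = (if f i = i then 1 else T $ i $ f i) * (\<Prod>v | f v \<noteq> v \<and> v \<noteq> i. T $ v $ f v)"
proof (cases "f i = i")
  case True
  then have "{v. f v \<noteq> v \<and> v \<noteq> i} = {v. f v \<noteq> v}" by auto
  then show ?thesis using True by (simp add: map_weight_def)
next
  case False
  have "{v. f v \<noteq> v} = insert i {v. f v \<noteq> v \<and> v \<noteq> i}" using False by auto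
  then show ?thesis using False by (simp add: map_weight_def)
qed

lemma map_weight_nonneg: "(\<And>u v. 0 \<le> T $ u $ v) \<Longrightarrow> 0 \<le> map_weight T f"
  unfolding map_weight_def by (intro prod_nonneg) auto

text \<open>Both sides are the factor of the arc from \<open>i\<close> to \<open>l\<close>, times
  that of the arc from \<open>i\<close> to \<open>f i\<close>, times the factors of the other
  vertices. An arc from \<open>i\<close> to itself stands for no arc and has factor 1.\<close>

lemma map_weight_exchange:
  "(if l = i then 1 else T $ i $ l) * map_weight T f =
   (if f i = i then 1 else T $ i $ f i) * map_weight T (f(i := l))"
proof -
  have "(\<Prod>v | (f(i := l)) v \<noteq> v \<and> v \<noteq> i. T $ v $ (f(i := l)) v) =
      (\<Prod>v | f v \<noteq> v \<and> v \<noteq> i. T $ v $ f v)"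
    by (rule prod.cong) auto
  then show ?thesis
    by (simp add: map_weight_split[of T f i] map_weight_split[of T "f(i := l)" i])
qed

text \<open>Trees with a root other than \<open>j\<close> correspond to pairs of a vertex
  \<open>l\<close> and a forest in \<open>forest_maps l j\<close>: cut the arc from \<open>j\<close>
  to \<open>l\<close>, or put it back. The arc accounts for the factor
  \<open>T $ j $ l\<close>.\<close>

lemma sum_tree_maps_eq:
  fixes T :: "real ^ 'n::finite ^ 'n"
  shows "(\<Sum>k\<in>UNIV. \<Sum>g\<in>tree_maps k. map_weight T g) =
     (\<Sum>g\<in>tree_maps j. map_weight T g) + (\<Sum>l\<in>UNIV. T $ j $ l * (\<Sum>f\<in>forest_maps l j. map_weight T f))"
proof -
  let ?P = "SIGMA l:UNIV. forest_maps l j"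
  let ?Q = "\<Union>k\<in>-{j}. tree_maps k"
  have "(\<Sum>l\<in>UNIV. T $ j $ l * (\<Sum>f\<in>forest_maps l j. map_weight T f)) =
      (\<Sum>(l, f)\<in>?P. T $ j $ l * map_weight T f)"
    by (simp add: sum_distrib_left sum.Sigma)
  also have "\<dots> = (\<Sum>g\<in>?Q. map_weight T g)"
  proof (rule sum.reindex_bij_witness[of _ "\<lambda>g. (g j, g(j := j))" "\<lambda>(l, f). f(j := l)"])
    fix p assume p: "p \<in> ?P"
    obtain l f where lf: "p = (l, f)" by force
    then have f: "f \<in> forest_maps l j" using p by auto
    then have fj: "f j = j" by (auto elim: forest_mapsE)
    \<comment> \<open>So the added arc is a genuine one and contributes its entry of
      \<open>T\<close>.\<close>
    have "l \<noteq> j" using f forest_maps_self[of j] by auto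
    show "(case p of (l, f) \<Rightarrow> f(j := l)) \<in> ?Q" using forest_maps_link_tree[OF f] lf by auto
    show "((case p of (l, f) \<Rightarrow> f(j := l)) j, (case p of (l, f) \<Rightarrow> f(j := l)) (j := j)) = p"
      using lf fj by (auto simp: fun_upd_idem)
    show "map_weight T (case p of (l, f) \<Rightarrow> f(j := l)) = (case p of (l, f) \<Rightarrow> T $ j $ l * map_weight T f)"
      using map_weight_exchange[of l j T f] lf fj \<open>l \<noteq> j\<close> by simp
  qed (auto intro: tree_maps_cut)
  also have "\<dots> = (\<Sum>k\<in>-{j}. \<Sum>g\<in>tree_maps k. map_weight T g)"
    by (rule sum.UNION_disjoint) (auto dest: tree_maps_fixpoint)
  finally show ?thesis
    by (simp add: sum.remove[of UNIV j] Compl_eq_Diff_UNIV)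
qed

text \<open>Both double sums run over pairs \<open>(l, f)\<close> with the same weight, so the pairs
  common to \<open>P\<close> and \<open>Q\<close> cancel. On the rest, exchanging the arc from
  \<open>i\<close> to \<open>l\<close> with the arc out of \<open>i\<close> matches
  \<open>P - Q\<close> with \<open>Q - P\<close> and the trees converging to
  \<open>j\<close>.\<close>

lemma sum_forest_maps_eq:
  fixes T :: "real ^ 'n::finite ^ 'n"
  assumes "i \<noteq> j"
  shows "(\<Sum>l\<in>UNIV. T $ i $ l * (\<Sum>f\<in>forest_maps i j. map_weight T f)) =
     (\<Sum>g\<in>tree_maps j. map_weight T g) + (\<Sum>l\<in>UNIV. T $ i $ l * (\<Sum>f\<in>forest_maps l j. map_weight T f))"
proof -
  define P Q :: "('n \<times> ('n \<Rightarrow> 'n)) set"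
    where "P = UNIV \<times> forest_maps i j" and "Q = (SIGMA l:UNIV. forest_maps l j)"
  define w where "w = (\<lambda>(l, f). T $ i $ l * map_weight T f)"
  \<comment> \<open>The first component \<open>i\<close> encodes a missing arc and gets factor 1, as
    in \<open>map_weight_exchange\<close>, instead of the diagonal entry of
    \<open>T\<close>.\<close>
  define w' where "w' = (\<lambda>(l, f). (if l = i then 1 else T $ i $ l) * map_weight T f)"
  \<comment> \<open>This swaps the stored successor of \<open>i\<close> with the one in use, so it
    is an involution and serves as its own inverse.\<close>
  define \<sigma> :: "'n \<times> ('n \<Rightarrow> 'n) \<Rightarrow> _" where "\<sigma> = (\<lambda>(l, f). (f i, f(i := l)))"
  \<comment> \<open>Trees result from forests in which \<open>i\<close> is a root; the stored
    successor is then \<open>i\<close> itself.\<close>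
  let ?R = "{i} \<times> tree_maps j"
  have P: "(\<Sum>l\<in>UNIV. T $ i $ l * (\<Sum>f\<in>forest_maps i j. map_weight T f)) = sum w P"
    by (simp add: w_def P_def sum_distrib_left sum.cartesian_product)
  have Q: "(\<Sum>l\<in>UNIV. T $ i $ l * (\<Sum>f\<in>forest_maps l j. map_weight T f)) = sum w Q"
    by (simp add: w_def Q_def sum_distrib_left sum.Sigma)
  have PQ: "(l, f) \<in> P - Q \<longleftrightarrow> f \<in> forest_maps i j \<and> l \<in> basin f j" for l f
    using forest_maps_switch[of f i j l] by (auto simp: P_def Q_def)
  have QP: "(l, f) \<in> Q - P \<longleftrightarrow> f \<in> forest_maps l j \<and> i \<in> basin f j" for l f
    using forest_maps_switch[of f l j i] by (auto simp: P_def Q_def)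
  have ww': "w p = w' p" if "p \<in> (P - Q) \<union> (Q - P)" for p
  proof -
    obtain l f where p: "p = (l, f)" by force
    \<comment> \<open>With \<open>l = i\<close>, either difference would place \<open>i\<close> in
      both trees of \<open>f\<close>; so the two weights agree there.\<close>
    then have "l \<noteq> i" using that PQ[of l f] QP[of l f] forest_maps_not_in_basin by auto
    then show ?thesis by (simp add: p w_def w'_def)
  qed
  have "sum w' (P - Q) = sum w' ((Q - P) \<union> ?R)"
  proof (rule sum.reindex_bij_witness[of _ \<sigma> \<sigma>])
    fix p assume p: "p \<in> P - Q"
    obtain l f where lf: "p = (l, f)" by force
    then have f: "f \<in> forest_maps i j" "l \<in> basin f j" using p PQ by auto
    show "\<sigma> p \<in> (Q - P) \<union> ?R"
      using forest_maps_swap_out[OF f] QP[of "f i" "f(i := l)"]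
      by (auto simp: lf \<sigma>_def split: if_splits)
  next
    fix p assume p: "p \<in> (Q - P) \<union> ?R"
    obtain l f where lf: "p = (l, f)" by force
    show "\<sigma> p \<in> P - Q"
    proof (cases "p \<in> Q - P")
      case True
      then have f: "f \<in> forest_maps l j" "i \<in> basin f j" using lf QP by auto
      show ?thesis
        using forest_maps_swap_in[OF f assms] PQ[of "f i" "f(i := l)"] by (simp add: lf \<sigma>_def)
    next
      case False
      then have l: "l = i" and f: "f \<in> tree_maps j" using p lf by auto
      then have f': "f j = j" "\<And>v. v \<in> basin f j" by (auto simp: tree_maps_def)
      \<comment> \<open>Removing the arc out of \<open>i\<close> from the tree makes
        \<open>i\<close> the second root.\<close>
      have "f(i := i) \<in> forest_maps i j"
      proof (rule forest_mapsI)
        show "v \<in> basin (f(i := i)) i \<or> v \<in> basin (f(i := i)) j" for v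
          using basin_update[of v f j i i] f' by blast
      qed (use assms f' in \<open>auto intro: basin_self\<close>)
      moreover have "f i \<in> basin (f(i := i)) j"
        using assms f' by (intro basin_update_apply) auto
      ultimately show ?thesis using PQ[of "f i" "f(i := i)"] by (simp add: lf l \<sigma>_def)
    qed
  next
    show "w' (\<sigma> p) = w' p" for p
    proof -
      obtain l f where "p = (l, f)" by force
      then show ?thesis using map_weight_exchange[of l i T f] by (simp add: \<sigma>_def w'_def)
    qed
  qed (auto simp: \<sigma>_def)
  also have "\<dots> = sum w' (Q - P) + sum w' ?R"
  proof (rule sum.union_disjoint)
    have "(i, f) \<notin> Q - P" for f using QP[of i f] forest_maps_not_in_basin[of f i j] by blast
    then show "(Q - P) \<inter> ?R = {}" by auto
  qed auto
  also have "sum w' ?R = (\<Sum>g\<in>tree_maps j. map_weight T g)"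
    by (simp add: w'_def flip: sum.cartesian_product)
  finally have "sum w (P - Q) = sum w (Q - P) + (\<Sum>g\<in>tree_maps j. map_weight T g)"
    using ww' by (metis (no_types, lifting) Un_iff sum.cong)
  moreover have "sum w P = sum w (P - Q) + sum w (P \<inter> Q)" "sum w Q = sum w (Q - P) + sum w (P \<inter> Q)"
    by (simp_all add: sum.Int_Diff[of P w Q] sum.Int_Diff[of Q w P] Int_commute)
  ultimately show ?thesis using P Q by simp
qed

text \<open>With \<open>d v\<close> the distance from \<open>v\<close> to \<open>j\<close>, let
  every other vertex step along a positive entry to a vertex closer to \<open>j\<close>. The
  resulting tree shows that the denominator of the formula is positive.\<close>

lemma irreducible_tree_map:
  assumes T: "\<And>u v. 0 \<le> T $ u $ v" and irr: "irreducible_matrix T"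
  shows "\<exists>g\<in>tree_maps j. 0 < map_weight T g"
proof -
  define d where "d v = (LEAST p. 0 < matrix_power T p $ v $ j)" for v
  have d: "0 < matrix_power T (d v) $ v $ j" for v
    unfolding d_def by (rule LeastI_ex[where P = "\<lambda>p. 0 < matrix_power T p $ v $ j"]) (use irr in \<open>auto simp: irreducible_matrix_def\<close>)
  have "\<exists>u. 0 < T $ v $ u \<and> d u < d v" if "v \<noteq> j" for v
  proof -
    \<comment> \<open>The power with exponent 0 is the identity matrix, which vanishes off the
      diagonal.\<close>
    have "d v \<noteq> 0" using d[of v] that by (cases "d v = 0") (auto simp: matrix_power_def mat_def)
    then obtain p where p: "d v = Suc p" by (cases "d v") auto
    have "matrix_power T (Suc p) = T ** matrix_power T p" by (simp add: matrix_power_def)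
    then have "0 < (\<Sum>u\<in>UNIV. T $ v $ u * matrix_power T p $ u $ j)"
      using d[of v] p by (simp add: matrix_matrix_mult_def)
    then obtain u where "0 < T $ v $ u * matrix_power T p $ u $ j"
      by (metis (no_types, lifting) not_le sum_nonpos)
    then have u: "0 < T $ v $ u" "0 < matrix_power T p $ u $ j"
      using T[of v u] by (auto simp: zero_less_mult_iff)
    have "d u \<le> p" unfolding d_def using u(2) by (rule Least_le)
    then show ?thesis using u p by auto
  qed
  then obtain s where s: "\<And>v. v \<noteq> j \<Longrightarrow> 0 < T $ v $ s v \<and> d (s v) < d v" by metis
  define g where "g = s(j := j)"
  have "v \<in> basin g j" for v
  proof (induction "d v" arbitrary: v rule: less_induct)
    case less
    show ?case
    proof (cases "v = j")
      case False
      then have "g v \<in> basin g j" using less s[of v] by (simp add: g_def)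
      then show ?thesis by (rule basin_step)
    qed (simp add: basin_self)
  qed
  then have "g \<in> tree_maps j" by (auto simp: tree_maps_def g_def)
  moreover have "0 < map_weight T g"
    unfolding map_weight_def by (intro prod_pos) (auto simp: g_def s)
  ultimately show ?thesis by blast
qed

section \<open>In-forests as functional graphs\<close>

definition full_digraph :: "('a \<times> 'a) set \<Rightarrow> ('a, 'a \<times> 'a) pre_digraph" where
  "full_digraph E = with_proj \<lparr>pverts = UNIV, parcs = E\<rparr>"

definition weak_class :: "('a \<times> 'a) set \<Rightarrow> 'a \<Rightarrow> 'a set" where
  "weak_class E u = {v. (u, v) \<in> (E\<^sup>s)\<^sup>*}"

text \<open>Restricting the tails restricts the heads too, since no arc leaves a weak class
  (\<open>weak_class_arc\<close>).\<close>

definition component :: "('a \<times> 'a) set \<Rightarrow> 'a \<Rightarrow> ('a, 'a \<times> 'a) pre_digraph" where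
  "component E u = with_proj \<lparr>pverts = weak_class E u, parcs = E \<inter> weak_class E u \<times> UNIV\<rparr>"

lemma full_digraph_simps [simp]:
  "verts (full_digraph E) = UNIV" "arcs (full_digraph E) = E"
  "tail (full_digraph E) = fst" "head (full_digraph E) = snd"
  by (simp_all add: full_digraph_def)

lemma component_simps [simp]:
  "verts (component E u) = weak_class E u" "arcs (component E u) = E \<inter> weak_class E u \<times> UNIV"
  "tail (component E u) = fst" "head (component E u) = snd"
  by (simp_all add: component_def)

lemma sym_symcl: "sym (E\<^sup>s)"
  by (auto simp: sym_def symcl_def image_iff)

lemma sym_reach: "(u, v) \<in> (E\<^sup>s)\<^sup>* \<Longrightarrow> (v, u) \<in> (E\<^sup>s)\<^sup>*"
  by (meson sym_rtrancl sym_symcl symD)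

lemma weak_class_self: "u \<in> weak_class E u"
  by (simp add: weak_class_def)

lemma weak_class_eq:
  assumes "v \<in> weak_class E u"
  shows "weak_class E v = weak_class E u"
  using assms sym_reach[of u v E] by (auto simp: weak_class_def intro: rtrancl_trans)

lemma weak_class_arc:
  assumes "(v, w) \<in> E"
  shows "v \<in> weak_class E u \<longleftrightarrow> w \<in> weak_class E u"
proof -
  have "(v, w) \<in> E\<^sup>s" "(w, v) \<in> E\<^sup>s" using assms by (auto simp: symcl_def)
  then show ?thesis unfolding weak_class_def by (auto intro: rtrancl_into_rtrancl)
qed

lemma component_eq: "v \<in> weak_class E u \<Longrightarrow> component E v = component E u"
  by (simp add: component_def weak_class_eq)

lemma wf_full_digraph: "wf_digraph (full_digraph E)"
  by unfold_locales auto

lemma subgraph_component: "subgraph (component E u) (full_digraph E)"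
proof (rule subgraphI)
  show "wf_digraph (component E u)"
    by unfold_locales (auto simp: weak_class_arc)
qed (auto simp: compatible_def wf_full_digraph)

lemma arcs_ends_fst_snd: "tail G = fst \<Longrightarrow> head G = snd \<Longrightarrow> arcs_ends G = arcs G"
  by (simp add: arcs_ends_conv)

text \<open>Connectedness asks for paths inside the vertex set. All vertices on a path from
  \<open>u\<close> lie in its class, so such paths qualify; any two vertices are then joined through
  \<open>u\<close> by symmetry.\<close>

lemma connected_component: "connected (component E u)"
proof -
  let ?S = "weak_class E u" and ?A = "(E \<inter> weak_class E u \<times> UNIV)\<^sup>s"
  have *: "(u, v) \<in> rtrancl_on ?S ?A" if "(u, v) \<in> (E\<^sup>s)\<^sup>*" for v
    using that
  proof (induction rule: rtrancl_induct)
    case base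
    show ?case by (simp add: weak_class_self)
  next
    case (step v w)
    then have "v \<in> ?S" "w \<in> ?S" by (auto simp: weak_class_def)
    moreover from this have "(v, w) \<in> ?A" using step.hyps(2) by (auto simp: symcl_def)
    ultimately show ?case using step.IH by (blast intro: rtrancl_on_into_rtrancl_on)
  qed
  have "sym (rtrancl_on ?S ?A)" by (rule rtrancl_on_sym[OF sym_symcl])
  then have "(v, w) \<in> rtrancl_on ?S ?A" if "v \<in> ?S" "w \<in> ?S" for v w
  proof -
    have "(u, v) \<in> rtrancl_on ?S ?A" "(u, w) \<in> rtrancl_on ?S ?A"
      using that by (auto simp: weak_class_def intro!: *[unfolded weak_class_def])
    then show ?thesis using symD[OF \<open>sym _\<close>] rtrancl_on_trans by metis
  qed
  then show ?thesis
    using weak_class_self[of u E] by (auto simp: connected_conv arcs_ends_fst_snd)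
qed

lemma subgraph_full_digraphD:
  assumes "subgraph H (full_digraph E)"
  shows "tail H = fst" "head H = snd" "arcs H \<subseteq> E" "\<And>a. a \<in> arcs H \<Longrightarrow> fst a \<in> verts H"
    "wf_digraph H"
proof -
  show *: "tail H = fst" "head H = snd" "arcs H \<subseteq> E" "wf_digraph H"
    using assms by (auto simp: subgraph_def compatible_def)
  show "fst a \<in> verts H" if "a \<in> arcs H" for a
    using wf_digraph.tail_in_verts[OF *(4) that] *(1) by simp
qed

text \<open>Paths in \<open>H\<close> are paths in \<open>E\<close>, so \<open>H\<close> stays
  within the weak class of \<open>u\<close>. This bound gives both directions of the description of
  the maximal connected subgraphs.\<close>

lemma connected_subgraph_component:
  assumes H: "subgraph H (full_digraph E)" and "connected H" and u: "u \<in> verts H"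
  shows "subgraph H (component E u)"
proof -
  note D = subgraph_full_digraphD[OF H]
  have "(arcs_ends H)\<^sup>s \<subseteq> E\<^sup>s"
    using D by (auto simp: arcs_ends_fst_snd symcl_def)
  then have mono: "((arcs_ends H)\<^sup>s)\<^sup>* \<subseteq> (E\<^sup>s)\<^sup>*" by (rule rtrancl_mono)
  have "(u, v) \<in> (E\<^sup>s)\<^sup>*" if "v \<in> verts H" for v
  proof -
    have "(u, v) \<in> rtrancl_on (verts H) ((arcs_ends H)\<^sup>s)"
      using \<open>connected H\<close> u that by (simp add: connected_conv)
    then have "(u, v) \<in> ((arcs_ends H)\<^sup>s)\<^sup>*" by (rule rtrancl_on_rtranclI)
    then show ?thesis using mono by blast
  qed
  then have verts: "verts H \<subseteq> weak_class E u" by (auto simp: weak_class_def)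
  show ?thesis
  proof (rule subgraphI)
    show "arcs H \<subseteq> arcs (component E u)"
    proof
      fix a assume "a \<in> arcs H"
      then show "a \<in> arcs (component E u)" using D(3) D(4)[of a] verts by (cases a) auto
    qed
    show "wf_digraph (component E u)" using subgraph_component[of E u] by (simp add: subgraph_def)
  qed (use D verts in \<open>auto simp: compatible_def\<close>)
qed

lemma weak_components_full_digraph:
  "weak_components (full_digraph E) = range (component E)"
proof (intro equalityI subsetI)
  fix C assume "C \<in> weak_components (full_digraph E)"
  then have C: "subgraph C (full_digraph E)" "connected C"
    and max: "\<And>H. H \<noteq> C \<Longrightarrow> subgraph C H \<Longrightarrow> \<not> (subgraph H (full_digraph E) \<and> connected H)"
    by (auto simp: weak_components_def pre_digraph.max_subgraph_def)
  obtain u where "u \<in> verts C" using C(2) by (auto simp: connected_conv)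
  then have "subgraph C (component E u)" using C by (intro connected_subgraph_component)
  then have "C = component E u"
    using max[of "component E u"] subgraph_component[of E u] connected_component[of E u] by argo
  then show "C \<in> range (component E)" by blast
next
  fix C assume "C \<in> range (component E)"
  then obtain u where C: "C = component E u" by blast
  have max: "H = C" if H: "subgraph C H" "subgraph H (full_digraph E)" "connected H" for H
  proof -
    have "u \<in> verts H" using H(1) weak_class_self[of u E] by (auto simp: C subgraph_def)
    then have sub: "subgraph H C" unfolding C using H by (intro connected_subgraph_component)
    then have "verts H = verts C" "arcs H = arcs C" "tail H = tail C" "head H = head C"
      using H(1) by (auto simp: subgraph_def compatible_def)
    then show ?thesis by (rule pre_digraph.equality) simp
  qed
  then show "C \<in> weak_components (full_digraph E)"
    using subgraph_component[of E u] connected_component[of E u] max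
    unfolding weak_components_def pre_digraph.max_subgraph_def C mem_Collect_eq by metis
qed

lemma out_degree_component:
  "v \<in> weak_class E u \<Longrightarrow> out_degree (component E u) v = card {a \<in> E. fst a = v}"
  unfolding out_degree_def by (rule arg_cong[of _ _ card]) (auto simp: out_arcs_def)

section \<open>Arc sets of self-maps\<close>

definition map_arcs :: "('a \<Rightarrow> 'a) \<Rightarrow> ('a \<times> 'a) set" where
  "map_arcs f = {(v, f v) | v. f v \<noteq> v}"

lemma out_degree_map_arcs: "card {a \<in> map_arcs f. fst a = v} = (if f v = v then 0 else 1)"
proof -
  have "{a \<in> map_arcs f. fst a = v} = (if f v = v then {} else {(v, f v)})"
    by (auto simp: map_arcs_def)
  then show ?thesis by simp
qed

text \<open>The arc out of \<open>v\<close> determines \<open>f v\<close>, and its absence means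
  that \<open>v\<close> is fixed.\<close>

lemma inj_map_arcs: "inj map_arcs"
proof (rule injI)
  fix f g :: "'a \<Rightarrow> 'a" assume eq: "map_arcs f = map_arcs g"
  have "f v = g v" for v
  proof (cases "f v = v")
    case True
    then have "(v, g v) \<notin> map_arcs g" by (subst eq[symmetric]) (auto simp: map_arcs_def)
    then show ?thesis using True by (auto simp: map_arcs_def)
  next
    case False
    then have "(v, f v) \<in> map_arcs g" by (subst eq[symmetric]) (auto simp: map_arcs_def)
    then show ?thesis by (auto simp: map_arcs_def)
  qed
  then show "f = g" by blast
qed

text \<open>Membership in the basin passes along arcs in both directions, forwards because
  \<open>r\<close> is fixed. Conversely, the orbit of a vertex of the basin is a path to
  \<open>r\<close>.\<close>

lemma weak_class_map_arcs:
  assumes r: "f r = r"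
  shows "weak_class (map_arcs f) r = basin f r"
proof (intro equalityI subsetI)
  fix v assume "v \<in> weak_class (map_arcs f) r"
  then have "(r, v) \<in> ((map_arcs f)\<^sup>s)\<^sup>*" by (simp add: weak_class_def)
  then show "v \<in> basin f r"
  proof (induction rule: rtrancl_induct)
    case (step v w)
    then have "w = f v \<or> v = f w" by (auto simp: symcl_def map_arcs_def)
    then show ?case using step.IH r basin_step basin_apply by metis
  qed (rule basin_self)
next
  fix v assume "v \<in> basin f r"
  then obtain k where "(f ^^ k) v = r" by (auto simp: basin_def)
  then show "v \<in> weak_class (map_arcs f) r"
  proof (induction k arbitrary: v)
    case 0
    then show ?case by (simp add: weak_class_self)
  next
    case (Suc k)
    then have "f v \<in> weak_class (map_arcs f) r" by (simp add: funpow_swap1)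
    then show ?case
      using weak_class_arc[of v "f v" "map_arcs f" r] by (cases "f v = v") (auto simp: map_arcs_def)
  qed
qed

text \<open>Vertices of outdegree zero are the fixed points, and the basin of a fixed point contains
  no other one; so the degree conditions hold automatically there.\<close>

lemma converging_tree_component:
  "converging_tree (component (map_arcs f) u) r \<longleftrightarrow> f r = r \<and> u \<in> basin f r"
proof
  assume *: "converging_tree (component (map_arcs f) u) r"
  then have r: "r \<in> weak_class (map_arcs f) u" by (simp add: converging_tree_def)
  then have "f r = r"
    using * by (auto simp: converging_tree_def out_degree_component out_degree_map_arcs split: if_splits)
  moreover from this have "u \<in> basin f r"
    using weak_class_eq[OF r] weak_class_map_arcs weak_class_self by metis
  ultimately show "f r = r \<and> u \<in> basin f r" by simp
next
  assume *: "f r = r \<and> u \<in> basin f r"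
  then have cls: "weak_class (map_arcs f) u = basin f r"
    using weak_class_map_arcs weak_class_eq by metis
  show "converging_tree (component (map_arcs f) u) r"
    using * fixpoint_in_basin_iff[of f _ r] basin_self[of r f]
    by (auto simp: converging_tree_def connected_component out_degree_component
      out_degree_map_arcs cls)
qed

section \<open>In-forests of the chain digraph\<close>

lemma chain_digraph_eq:
  "chain_digraph T = full_digraph {(a, b). a \<noteq> b \<and> T $ a $ b \<noteq> 0}"
  by (simp add: chain_digraph_def full_digraph_def)

definition supported_maps :: "real ^ 'n ^ 'n \<Rightarrow> ('n::finite \<Rightarrow> 'n) set" where
  "supported_maps T = {f. \<forall>v. f v \<noteq> v \<longrightarrow> T $ v $ f v \<noteq> 0}"

lemma in_forest_map_arcs:
  "in_forest (full_digraph (map_arcs f)) (chain_digraph T) \<longleftrightarrow>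
     f \<in> supported_maps T \<and> (\<forall>v. \<exists>r. f r = r \<and> v \<in> basin f r)"
proof -
  have "spanning (full_digraph (map_arcs f)) (chain_digraph T) \<longleftrightarrow> f \<in> supported_maps T"
    by (auto simp: spanning_def subgraph_def wf_full_digraph chain_digraph_eq compatible_def
        map_arcs_def supported_maps_def)
  moreover have "(\<exists>r. converging_tree (component (map_arcs f) v) r) \<longleftrightarrow>
      (\<exists>r. f r = r \<and> v \<in> basin f r)" for v
    by (simp only: converging_tree_component)
  ultimately show ?thesis by (simp add: in_forest_def weak_components_full_digraph)
qed

text \<open>Every vertex lies in a converging tree and so has at most one outgoing arc: the arc set
  is the graph of a partial function.\<close>

lemma in_forestE:
  assumes F: "in_forest F (chain_digraph T)"
  obtains f where "F = full_digraph (map_arcs f)"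
proof -
  let ?G = "{(a, b). a \<noteq> b \<and> T $ a $ b \<noteq> 0}"
  define E where "E = arcs F"
  have "subgraph F (full_digraph ?G)" "verts F = UNIV"
    using F by (auto simp: in_forest_def spanning_def chain_digraph_eq)
  then have F_eq: "F = full_digraph E" and loop: "\<And>v. (v, v) \<notin> E"
    by (auto simp: E_def subgraph_def compatible_def intro!: pre_digraph.equality)
  have card: "card {a \<in> E. fst a = v} \<le> 1" for v
  proof -
    obtain r where "converging_tree (component E v) r"
      using F by (auto simp: in_forest_def F_eq weak_components_full_digraph)
    then have "out_degree (component E v) v \<le> 1"
      using weak_class_self[of v E] by (cases "v = r") (simp_all add: converging_tree_def)
    then show ?thesis by (simp only: out_degree_component[OF weak_class_self])
  qed
  have uniq: "w = w'" if "(v, w) \<in> E" "(v, w') \<in> E" for v w w'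
  proof -
    have "(v, w) = (v, w')"
      by (rule card_le_Suc0_iff_eq[THEN iffD1, rule_format, of "{a \<in> E. fst a = v}"])
        (use card[of v] that in auto)
    then show ?thesis by simp
  qed
  \<comment> \<open>Vertices without an outgoing arc, the roots, become fixed points.\<close>
  define f where "f v = (if \<exists>w. (v, w) \<in> E then THE w. (v, w) \<in> E else v)" for v
  have f: "f v = w" if "(v, w) \<in> E" for v w
  proof -
    have "(THE w. (v, w) \<in> E) = w" using that uniq by (intro the_equality)
    then show ?thesis using that by (auto simp: f_def)
  qed
  have "map_arcs f = E"
  proof (intro equalityI subsetI)
    fix a assume "a \<in> map_arcs f"
    then obtain v where v: "a = (v, f v)" "f v \<noteq> v" by (auto simp: map_arcs_def)
    then obtain w where "(v, w) \<in> E" by (auto simp: f_def split: if_splits)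
    then show "a \<in> E" using v f by metis
  next
    fix a assume "a \<in> E"
    then show "a \<in> map_arcs f" using f[of "fst a" "snd a"] loop[of "fst a"]
      by (cases a) (auto simp: map_arcs_def)
  qed
  then show ?thesis using that[of f] F_eq by simp
qed

lemma spanning_converging_trees_eq:
  "spanning_converging_trees (chain_digraph T) j =
     (\<lambda>f. full_digraph (map_arcs f)) ` (tree_maps j \<inter> supported_maps T)"
proof (intro equalityI subsetI)
  fix F assume "F \<in> spanning_converging_trees (chain_digraph T) j"
  then obtain C where F: "in_forest F (chain_digraph T)"
    and C: "weak_components F = {C}" "converging_tree C j"
    by (auto simp: spanning_converging_trees_def)
  from in_forestE[OF F] obtain f where f: "F = full_digraph (map_arcs f)" .
  have "component (map_arcs f) u = C" for u
    using C(1) by (auto simp: f weak_components_full_digraph)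
  then have "f j = j \<and> u \<in> basin f j" for u
    using C(2) by (metis converging_tree_component)
  then have "f \<in> tree_maps j" by (auto simp: tree_maps_def)
  then show "F \<in> (\<lambda>f. full_digraph (map_arcs f)) ` (tree_maps j \<inter> supported_maps T)"
    using F by (auto simp: f in_forest_map_arcs)
next
  fix F assume "F \<in> (\<lambda>f. full_digraph (map_arcs f)) ` (tree_maps j \<inter> supported_maps T)"
  then obtain f where f: "F = full_digraph (map_arcs f)" "f \<in> supported_maps T"
    "f j = j" "\<And>v. v \<in> basin f j"
    by (auto simp: tree_maps_def)
  have "component (map_arcs f) u = component (map_arcs f) j" for u
    by (rule component_eq) (simp add: weak_class_map_arcs f)
  then have "weak_components F = {component (map_arcs f) j}"
    by (auto simp: f(1) weak_components_full_digraph)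
  moreover have "in_forest F (chain_digraph T)"
    unfolding f(1) in_forest_map_arcs using f by blast
  ultimately show "F \<in> spanning_converging_trees (chain_digraph T) j"
    using f by (auto simp: spanning_converging_trees_def converging_tree_component)
qed

text \<open>The witness \<open>k\<close> in \<open>forest_maps\<close> is the root of the component
  \<open>C\<close> that contains \<open>i\<close>.\<close>

lemma two_tree_in_forests_eq:
  "two_tree_in_forests (chain_digraph T) i j =
     (\<lambda>f. full_digraph (map_arcs f)) ` (forest_maps i j \<inter> supported_maps T)"
proof (intro equalityI subsetI)
  fix F assume "F \<in> two_tree_in_forests (chain_digraph T) i j"
  then obtain C D where F: "in_forest F (chain_digraph T)"
    and CD: "C \<noteq> D" "weak_components F = {C, D}" "i \<in> verts C" "converging_tree D j"
    unfolding two_tree_in_forests_def by blast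
  from in_forestE[OF F] obtain f where f: "F = full_digraph (map_arcs f)" .
  have comp: "component (map_arcs f) u = C \<or> component (map_arcs f) u = D" for u
    using CD(2) by (auto simp: f weak_components_full_digraph)
  have "D \<in> weak_components F" "C \<in> weak_components F" using CD by auto
  then obtain d c where dc: "D = component (map_arcs f) d" "C = component (map_arcs f) c"
    by (auto simp: f weak_components_full_digraph)
  then have j: "f j = j" using CD by (simp add: converging_tree_component)
  obtain k where k: "converging_tree C k"
    using F CD by (auto simp: in_forest_def)
  then have fk: "f k = k" using dc by (simp add: converging_tree_component)
  have cover: "u \<in> basin f k \<or> u \<in> basin f j" for u
    using comp[of u] k CD(4) converging_tree_component[of f u] by metis
  \<comment> \<open>A common root would lie in both weak classes and make the components
    equal.\<close>
  have "k \<noteq> j"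
  proof
    assume "k = j"
    then have "j \<in> weak_class (map_arcs f) c" "j \<in> weak_class (map_arcs f) d"
      using k CD(4) dc by (auto simp: converging_tree_def)
    then have "D = component (map_arcs f) j" "C = component (map_arcs f) j"
      using component_eq dc by metis+
    then show False using CD(1) by simp
  qed
  moreover have "i \<in> basin f k"
  proof -
    have "component (map_arcs f) i = C" using CD(3) dc component_eq by auto
    then show ?thesis using k converging_tree_component by metis
  qed
  ultimately have "f \<in> forest_maps i j" using j fk cover by (auto simp: forest_maps_def)
  then show "F \<in> (\<lambda>f. full_digraph (map_arcs f)) ` (forest_maps i j \<inter> supported_maps T)"
    using F by (auto simp: f in_forest_map_arcs)
next
  fix F assume "F \<in> (\<lambda>f. full_digraph (map_arcs f)) ` (forest_maps i j \<inter> supported_maps T)"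
  then obtain f k where f: "F = full_digraph (map_arcs f)" "f \<in> supported_maps T"
    and j: "f j = j" and k: "k \<noteq> j" "f k = k" "i \<in> basin f k" and "basin f k \<union> basin f j = UNIV"
    by (auto simp: forest_maps_def)
  then have cover: "v \<in> basin f k \<or> v \<in> basin f j" for v by blast
  let ?C = "component (map_arcs f)"
  have "?C u = ?C k \<or> ?C u = ?C j" for u
    using cover[of u] component_eq[of u "map_arcs f"] by (auto simp: weak_class_map_arcs j k)
  then have "weak_components F = {?C k, ?C j}"
    by (auto simp: f(1) weak_components_full_digraph)
  moreover have "?C k \<noteq> ?C j"
  proof
    assume "?C k = ?C j"
    then have "verts (?C k) = verts (?C j)" by simp
    then show False
      using k j basin_self[of k f] fixpoint_in_basin_iff[of f k j] by (simp add: weak_class_map_arcs)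
  qed
  moreover have "i \<in> verts (?C k)" using k by (simp add: weak_class_map_arcs)
  moreover have "converging_tree (?C j) j" using j by (simp add: converging_tree_component basin_self)
  moreover have "in_forest F (chain_digraph T)"
    unfolding f(1) in_forest_map_arcs using f(2) j k cover by blast
  ultimately show "F \<in> two_tree_in_forests (chain_digraph T) i j"
    unfolding two_tree_in_forests_def by blast
qed

section \<open>Weights of in-forests\<close>

lemma digraph_weight_map_arcs:
  "digraph_weight (arc_weight T) (full_digraph (map_arcs f)) = map_weight T f"
proof -
  have "map_arcs f = (\<lambda>v. (v, f v)) ` {v. f v \<noteq> v}" by (auto simp: map_arcs_def)
  moreover have "inj_on (\<lambda>v. (v, f v)) {v. f v \<noteq> v}" by (auto intro: inj_onI)
  ultimately show ?thesis
    by (simp add: digraph_weight_def map_weight_def arc_weight_def prod.reindex)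
qed

text \<open>A map that uses an arc absent from the digraph has a zero factor. This is why
  \<open>tree_maps\<close> and \<open>forest_maps\<close> can be defined without regard to
  \<open>T\<close>.\<close>

lemma total_weight_map_arcs:
  fixes T :: "real ^ 'n::finite ^ 'n"
  shows "total_weight (arc_weight T) ((\<lambda>f. full_digraph (map_arcs f)) ` (A \<inter> supported_maps T)) =
     (\<Sum>f\<in>A. map_weight T f)"
proof -
  have "inj_on (\<lambda>f. full_digraph (map_arcs f)) (A \<inter> supported_maps T)"
    by (intro inj_onI) (metis full_digraph_simps(2) injD inj_map_arcs)
  then have "total_weight (arc_weight T) ((\<lambda>f. full_digraph (map_arcs f)) ` (A \<inter> supported_maps T)) =
      (\<Sum>f\<in>A \<inter> supported_maps T. map_weight T f)"
    by (simp add: total_weight_def sum.reindex digraph_weight_map_arcs)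
  also have "\<dots> = (\<Sum>f\<in>A. map_weight T f)"
    by (rule sum.mono_neutral_left) (auto simp: supported_maps_def map_weight_def)
  finally show ?thesis .
qed

lemma tree_weight_eq: "tree_weight T j = (\<Sum>f\<in>tree_maps j. map_weight T f)"
  by (simp add: tree_weight_def spanning_converging_trees_eq total_weight_map_arcs)

lemma forest_weight_eq: "forest_weight T i j = (\<Sum>f\<in>forest_maps i j. map_weight T f)"
  by (simp add: forest_weight_def two_tree_in_forests_eq total_weight_map_arcs)

section \<open>First-step equations and the hitting time\<close>

text \<open>The Markov property is given for single histories; an event determined by the times up
  to \<open>p\<close> is a finite disjoint union of them. The assumption \<open>local\<close>
  expresses this dependence on the past.\<close>

lemma markov_chain_event_step:
  fixes T :: "real ^ 'n::finite ^ 'n"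
  assumes chain: "markov_chain M X T"
    and local: "\<And>x y. (\<And>k. k \<le> p \<Longrightarrow> x k = y k) \<Longrightarrow> P x = P y"
  shows "\<P>(\<omega> in M. P (\<lambda>k. X k \<omega>) \<and> X p \<omega> = b \<and> X (Suc p) \<omega> = c) =
    \<P>(\<omega> in M. P (\<lambda>k. X k \<omega>) \<and> X p \<omega> = b) * T $ b $ c"
proof -
  interpret prob_space M using chain by (simp add: markov_chain_def)
  have [measurable]: "X p \<in> measurable M (count_space UNIV)" for p
    using chain by (simp add: markov_chain_def)
  \<comment> \<open>Histories are taken as extensional functions, so that there are finitely many
    and each outcome has exactly one.\<close>
  define A where "A = {x \<in> {..p} \<rightarrow>\<^sub>E (UNIV :: 'n set). P x \<and> x p = b}"
  have "finite ({..p} \<rightarrow>\<^sub>E (UNIV :: 'n set))" by (intro finite_PiE) auto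
  then have [simp]: "finite A" by (simp add: A_def)
  have step: "\<P>(\<omega> in M. (\<forall>k\<le>p. X k \<omega> = x k) \<and> X (Suc p) \<omega> = c) =
      \<P>(\<omega> in M. \<forall>k\<le>p. X k \<omega> = x k) * T $ x p $ c" for x
  proof (cases "\<P>(\<omega> in M. \<forall>k\<le>p. X k \<omega> = x k) > 0")
    case True
    then have "\<P>(\<omega> in M. X (Suc p) \<omega> = c \<bar> \<forall>k\<le>p. X k \<omega> = x k) = T $ x p $ c"
      using chain by (simp add: markov_chain_def)
    then show ?thesis using True by (simp add: cond_prob_def field_simps conj_commute)
  next
    case False
    \<comment> \<open>The chain says nothing about null histories, but there both sides
      vanish.\<close>
    then have 0: "\<P>(\<omega> in M. \<forall>k\<le>p. X k \<omega> = x k) = 0" by (simp add: zero_less_measure_iff)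
    have "\<P>(\<omega> in M. (\<forall>k\<le>p. X k \<omega> = x k) \<and> X (Suc p) \<omega> = c) \<le> \<P>(\<omega> in M. \<forall>k\<le>p. X k \<omega> = x k)"
      by (intro finite_measure_mono) auto
    then show ?thesis using 0 measure_nonneg by (simp add: order_antisym)
  qed
  have split: "\<P>(\<omega> in M. P (\<lambda>k. X k \<omega>) \<and> X p \<omega> = b \<and> R \<omega>) =
      (\<Sum>x\<in>A. \<P>(\<omega> in M. (\<forall>k\<le>p. X k \<omega> = x k) \<and> R \<omega>))"
    if [measurable]: "Measurable.pred M R" for R
  proof -
    have "{\<omega> \<in> space M. P (\<lambda>k. X k \<omega>) \<and> X p \<omega> = b \<and> R \<omega>} =
        (\<Union>x\<in>A. {\<omega> \<in> space M. (\<forall>k\<le>p. X k \<omega> = x k) \<and> R \<omega>})"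
    proof (intro equalityI subsetI)
      fix \<omega> assume \<omega>: "\<omega> \<in> {\<omega> \<in> space M. P (\<lambda>k. X k \<omega>) \<and> X p \<omega> = b \<and> R \<omega>}"
      let ?x = "restrict (\<lambda>k. X k \<omega>) {..p}"
      have "P ?x = P (\<lambda>k. X k \<omega>)" by (rule local) simp
      then have "?x \<in> A" using \<omega> by (simp add: A_def)
      then show "\<omega> \<in> (\<Union>x\<in>A. {\<omega> \<in> space M. (\<forall>k\<le>p. X k \<omega> = x k) \<and> R \<omega>})"
        using \<omega> by (intro UN_I[of ?x]) auto
    next
      fix \<omega> assume "\<omega> \<in> (\<Union>x\<in>A. {\<omega> \<in> space M. (\<forall>k\<le>p. X k \<omega> = x k) \<and> R \<omega>})"
      then obtain x where x: "x \<in> A" "\<omega> \<in> space M" "\<And>k. k \<le> p \<Longrightarrow> X k \<omega> = x k" "R \<omega>" by auto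
      have "P (\<lambda>k. X k \<omega>) = P x" by (rule local) (rule x)
      then show "\<omega> \<in> {\<omega> \<in> space M. P (\<lambda>k. X k \<omega>) \<and> X p \<omega> = b \<and> R \<omega>}"
        using x by (simp add: A_def)
    qed
    moreover have "disjoint_family_on (\<lambda>x. {\<omega> \<in> space M. (\<forall>k\<le>p. X k \<omega> = x k) \<and> R \<omega>}) A"
      unfolding disjoint_family_on_def
    proof (intro ballI impI)
      fix x y assume xy: "x \<in> A" "y \<in> A" "x \<noteq> y"
      have "x = y" if "\<And>k. k \<le> p \<Longrightarrow> x k = y k"
        using xy(1,2) that by (intro PiE_ext[of x "{..p}" "\<lambda>_. UNIV" y]) (auto simp: A_def)
      then obtain k where "k \<le> p" "x k \<noteq> y k" using xy(3) by blast
      then show "{\<omega> \<in> space M. (\<forall>k\<le>p. X k \<omega> = x k) \<and> R \<omega>} \<inter>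
          {\<omega> \<in> space M. (\<forall>k\<le>p. X k \<omega> = y k) \<and> R \<omega>} = {}" by auto
    qed
    ultimately show ?thesis
      by (simp add: finite_measure_finite_Union image_subset_iff)
  qed
  have "\<P>(\<omega> in M. P (\<lambda>k. X k \<omega>) \<and> X p \<omega> = b \<and> X (Suc p) \<omega> = c) =
      (\<Sum>x\<in>A. \<P>(\<omega> in M. \<forall>k\<le>p. X k \<omega> = x k) * T $ x p $ c)"
    by (subst split) (simp_all add: step)
  also have "\<dots> = (\<Sum>x\<in>A. \<P>(\<omega> in M. \<forall>k\<le>p. X k \<omega> = x k)) * T $ b $ c"
    unfolding sum_distrib_right by (rule sum.cong) (auto simp: A_def)
  also have "(\<Sum>x\<in>A. \<P>(\<omega> in M. \<forall>k\<le>p. X k \<omega> = x k)) = \<P>(\<omega> in M. P (\<lambda>k. X k \<omega>) \<and> X p \<omega> = b)"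
    using split[of "\<lambda>_. True"] by simp
  finally show ?thesis .
qed

text \<open>Here \<open>a p b\<close> is the mass at \<open>b\<close> after \<open>p\<close> steps of the process killed at \<open>j\<close>; the potential
  \<open>\<Sum>b. a p b * H b\<close> drops by exactly the surviving mass in each step.\<close>

lemma killed_mass_sums:
  fixes T :: "real ^ 'n::finite ^ 'n" and a :: "nat \<Rightarrow> 'n \<Rightarrow> real"
  assumes H: "\<And>b. H b = 1 + (\<Sum>c\<in>-{j}. T $ b $ c * H c)" and H0: "\<And>b. 0 \<le> H b"
    and a0: "\<And>p b. 0 \<le> a p b"
    and step: "\<And>p c. a (Suc p) c = (if c = j then 0 else \<Sum>b\<in>UNIV. a p b * T $ b $ c)"
  shows "(\<lambda>p. \<Sum>b\<in>UNIV. a p b) sums (\<Sum>b\<in>UNIV. a 0 b * H b)"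
proof -
  define S where "S p = (\<Sum>b\<in>UNIV. a p b * H b)" for p
  define s where "s p = (\<Sum>b\<in>UNIV. a p b)" for p
  have "S (Suc p) = S p - s p" for p
  proof -
    have "S (Suc p) = (\<Sum>c\<in>-{j}. (\<Sum>b\<in>UNIV. a p b * T $ b $ c) * H c)"
      unfolding S_def by (rule sum.mono_neutral_cong_right) (auto simp: step)
    also have "\<dots> = (\<Sum>b\<in>UNIV. a p b * (\<Sum>c\<in>-{j}. T $ b $ c * H c))"
      by (simp add: sum_distrib_left sum_distrib_right mult.assoc) (rule sum.swap)
    also have "\<dots> = (\<Sum>b\<in>UNIV. a p b * (H b - 1))"
    proof (rule sum.cong)
      show "a p b * (\<Sum>c\<in>-{j}. T $ b $ c * H c) = a p b * (H b - 1)" for b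
        by (subst H[of b]) simp
    qed simp
    finally show ?thesis by (simp add: S_def s_def right_diff_distrib sum_subtractf)
  qed
  then have s: "s p = S p - S (Suc p)" for p by simp
  have S0: "0 \<le> S p" and s0: "0 \<le> s p" for p
    unfolding S_def s_def using a0 H0 by (auto intro!: sum_nonneg)
  have "(\<Sum>p<n. s p) \<le> S 0" for n
    using S0[of n] by (simp add: s sum_lessThan_telescope')
  then have "summable s" using s0 by (intro summableI_nonneg_bounded)
  then have "s \<longlonglongrightarrow> 0" by (rule summable_LIMSEQ_zero)
  then have lim: "(\<lambda>p. s p * (\<Sum>b\<in>UNIV. H b)) \<longlonglongrightarrow> 0" by (rule tendsto_mult_left_zero)
  \<comment> \<open>The surviving mass is summable and tends to 0; this bound makes the potential
    vanish in the limit, so the telescoping sum leaves exactly \<open>S 0\<close>.\<close>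
  have "S p \<le> s p * (\<Sum>b\<in>UNIV. H b)" for p
  proof -
    have "H b \<le> (\<Sum>b\<in>UNIV. H b)" for b using H0 by (intro member_le_sum) auto
    then show ?thesis unfolding S_def s_def sum_distrib_right
      using a0 by (intro sum_mono mult_left_mono)
  qed
  then have "S \<longlonglongrightarrow> 0"
    using S0 by (intro tendsto_sandwich[OF _ _ tendsto_const lim]) auto
  then have "(\<lambda>p. S p - S (Suc p)) sums (S 0 - 0)" by (rule telescope_sums')
  then show ?thesis unfolding s[symmetric] by (simp add: S_def s_def)
qed

text \<open>The expectation is the sum over \<open>t\<close> of the probabilities that the passage
  time exceeds \<open>t\<close>. These are the masses surviving in the chain killed at
  \<open>j\<close>, whose sum is given by \<open>killed_mass_sums\<close>.\<close>

lemma hitting_time_eqI: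
  fixes T :: "real ^ 'n::finite ^ 'n"
  assumes chain: "markov_chain M X T" and pos: "\<P>(\<omega> in M. X 0 \<omega> = i) > 0"
    and H: "\<And>b. H b = 1 + (\<Sum>c\<in>-{j}. T $ b $ c * H c)" and H0: "\<And>b. 0 \<le> H b"
  shows "hitting_time M X i j = ennreal (H i)"
proof -
  interpret prob_space M using chain by (simp add: markov_chain_def)
  have [measurable]: "X p \<in> measurable M (count_space UNIV)" for p
    using chain by (simp add: markov_chain_def)
  define F where "F = first_passage X j"
  define I where "I = {\<omega> \<in> space M. X 0 \<omega> = i}"
  define N where "N = uniform_measure M I"
  \<comment> \<open>Time 0 is exempt from avoiding \<open>j\<close>, so that \<open>i = j\<close>
    yields the return time.\<close>
  define Q where "Q p x \<longleftrightarrow> x 0 = i \<and> (\<forall>l\<in>{0<..p}. x l \<noteq> j)" for p and x :: "nat \<Rightarrow> 'n"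
  \<comment> \<open>These are joint probabilities with the event of starting in \<open>i\<close>;
    the initial mass is therefore \<open>prob I\<close>, which is divided out at the end.\<close>
  define a where "a p b = \<P>(\<omega> in M. Q p (\<lambda>k. X k \<omega>) \<and> X p \<omega> = b)" for p b
  have [measurable]: "I \<in> sets M" unfolding I_def by measurable
  have [measurable]: "Measurable.pred M (\<lambda>\<omega>. Q p (\<lambda>k. X k \<omega>))" for p
    unfolding Q_def by measurable
  have total: "\<P>(\<omega> in M. R \<omega>) = (\<Sum>b\<in>UNIV. \<P>(\<omega> in M. R \<omega> \<and> X p \<omega> = b))"
    if [measurable]: "Measurable.pred M R" for R p
  proof -
    have "{\<omega> \<in> space M. R \<omega>} = (\<Union>b. {\<omega> \<in> space M. R \<omega> \<and> X p \<omega> = b})" by auto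
    moreover have "disjoint_family (\<lambda>b. {\<omega> \<in> space M. R \<omega> \<and> X p \<omega> = b})"
      by (auto simp: disjoint_family_on_def)
    ultimately show ?thesis by (simp add: finite_measure_finite_Union image_subset_iff)
  qed
  have step: "a (Suc p) c = (if c = j then 0 else \<Sum>b\<in>UNIV. a p b * T $ b $ c)" for p c
  proof (cases "c = j")
    case True
    have "\<not> (Q (Suc p) x \<and> x (Suc p) = j)" for x
      unfolding Q_def by (auto intro: bexI[of _ "Suc p"])
    then have "{\<omega> \<in> space M. Q (Suc p) (\<lambda>k. X k \<omega>) \<and> X (Suc p) \<omega> = j} = {}" by fast
    then show ?thesis unfolding a_def True by (simp only: measure_empty simp_thms if_True)
  next
    case False
    have "{0<..Suc p} = insert (Suc p) {0<..p}" by auto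
    then have "Q (Suc p) (\<lambda>k. X k \<omega>) \<and> X (Suc p) \<omega> = c \<longleftrightarrow>
        Q p (\<lambda>k. X k \<omega>) \<and> X (Suc p) \<omega> = c" for \<omega>
      using False by (auto simp: Q_def)
    then have "a (Suc p) c = \<P>(\<omega> in M. Q p (\<lambda>k. X k \<omega>) \<and> X (Suc p) \<omega> = c)"
      by (simp add: a_def)
    also have "\<dots> = (\<Sum>b\<in>UNIV. \<P>(\<omega> in M. Q p (\<lambda>k. X k \<omega>) \<and> X p \<omega> = b \<and> X (Suc p) \<omega> = c))"
      by (subst total[of _ p]) (simp_all add: conj_ac)
    also have "\<dots> = (\<Sum>b\<in>UNIV. a p b * T $ b $ c)"
      unfolding a_def by (intro sum.cong refl markov_chain_event_step[OF chain]) (auto simp: Q_def)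
    finally show ?thesis using False by simp
  qed
  have init: "a 0 b = (if b = i then prob I else 0)" for b
  proof -
    have "{\<omega> \<in> space M. Q 0 (\<lambda>k. X k \<omega>) \<and> X 0 \<omega> = b} = (if b = i then I else {})"
      by (auto simp: Q_def I_def)
    then show ?thesis by (simp add: a_def)
  qed
  have "(\<Sum>b\<in>UNIV. a 0 b * H b) = prob I * H i"
    by (simp add: init if_distrib[where f = "\<lambda>x. x * _"] cong: if_cong)
  moreover have "(\<lambda>p. \<Sum>b\<in>UNIV. a p b) sums (\<Sum>b\<in>UNIV. a 0 b * H b)"
    using H H0 by (rule killed_mass_sums) (simp_all add: step, simp add: a_def)
  moreover have "(\<Sum>b\<in>UNIV. a p b) = \<P>(\<omega> in M. Q p (\<lambda>k. X k \<omega>))" for p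
    unfolding a_def by (rule total[symmetric]) measurable
  ultimately have "(\<lambda>p. \<P>(\<omega> in M. Q p (\<lambda>k. X k \<omega>))) sums (prob I * H i)" by simp
  then have sums: "(\<lambda>p. \<P>(\<omega> in M. Q p (\<lambda>k. X k \<omega>)) / prob I) sums H i"
    using sums_divide[of _ "prob I * H i" "prob I"] pos by (simp add: I_def)
  have [simp]: "space N = space M" "sets N = sets M" by (simp_all add: N_def)
  have gt: "enat t < F \<omega> \<longleftrightarrow> (\<forall>l\<in>{0<..t}. X l \<omega> \<noteq> j)" for t \<omega>
  proof -
    have "F \<omega> \<le> enat t \<longleftrightarrow> (\<exists>l\<in>{0<..t}. X l \<omega> = j)"
    proof
      assume "F \<omega> \<le> enat t"
      then obtain m where "F \<omega> = enat m" "m \<le> t" by (cases "F \<omega>") auto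
      then show "\<exists>l\<in>{0<..t}. X l \<omega> = j"
        by (auto simp: F_def first_passage_eq_enat_iff)
    next
      assume "\<exists>l\<in>{0<..t}. X l \<omega> = j"
      then obtain l where l: "l \<in> {0<..t}" "X l \<omega> = j" by blast
      then have "F \<omega> \<le> enat l" unfolding F_def first_passage_def by (intro INF_lower) simp
      also have "\<dots> \<le> enat t" using l by simp
      finally show "F \<omega> \<le> enat t" .
    qed
    then show ?thesis unfolding not_le[symmetric] by blast
  qed
  have [measurable]: "{\<omega> \<in> space M. enat t < F \<omega>} \<in> sets M" for t
    unfolding gt by measurable
  have "F \<in> measurable N (count_space UNIV)"
  proof -
    have "{\<omega> \<in> space M. F \<omega> = enat k} \<in> sets M" for k
      unfolding F_def first_passage_eq_enat_iff by measurable
    moreover have "{\<omega> \<in> space M. F \<omega> = \<infinity>} = space M - (\<Union>k. {\<omega> \<in> space M. F \<omega> = enat k})"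
      by (auto simp: not_infinity_eq)
    ultimately have "{\<omega> \<in> space M. F \<omega> = y} \<in> sets M" for y by (cases y) auto
    then show ?thesis
      by (auto simp: measurable_count_space_eq2_countable vimage_def Int_def conj_commute)
  qed
  then have "hitting_time M X i j = (\<Sum>t. emeasure N {\<omega> \<in> space N. enat t < F \<omega>})"
    unfolding hitting_time_def N_def I_def F_def by (rule nn_integral_enat_function)
  also have "\<dots> = (\<Sum>t. ennreal (\<P>(\<omega> in M. Q t (\<lambda>k. X k \<omega>)) / prob I))"
  proof (rule suminf_cong)
    fix t
    have "I \<inter> {\<omega> \<in> space M. enat t < F \<omega>} = {\<omega> \<in> space M. Q t (\<lambda>k. X k \<omega>)}"
      by (auto simp: I_def Q_def gt)
    then show "emeasure N {\<omega> \<in> space N. enat t < F \<omega>} = ennreal (\<P>(\<omega> in M. Q t (\<lambda>k. X k \<omega>)) / prob I)"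
      using pos by (simp add: N_def emeasure_uniform_measure emeasure_eq_measure divide_ennreal I_def)
  qed
  also have "\<dots> = ennreal (H i)"
    by (rule suminf_ennreal_eq[OF _ sums]) simp
  finally show ?thesis .
qed

theorem theorem1:
  fixes T :: "real ^ 'n::finite ^ 'n::finite"
    and M :: "'a measure"
    and X :: "nat \<Rightarrow> 'a \<Rightarrow> 'n"
    and i j :: 'n
  assumes "stochastic_matrix T"
    and "irreducible_matrix T"
    and "markov_chain M X T"
    and "\<P>(\<omega> in M. X 0 \<omega> = i) > 0"
  shows "hitting_time M X i j =
           ennreal (inverse (tree_weight T j) *
             (if i \<noteq> j then forest_weight T i j else (\<Sum>k\<in>UNIV. tree_weight T k)))"
proof -
  have T0: "\<And>u v. 0 \<le> T $ u $ v" and T1: "\<And>u. (\<Sum>v\<in>UNIV. T $ u $ v) = 1"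
    using assms(1) by (auto simp: stochastic_matrix_def)
  \<comment> \<open>The claimed formula is taken for every starting state, as the first-step
    equations couple them all.\<close>
  define H where "H b = inverse (tree_weight T j) *
      (if b \<noteq> j then forest_weight T b j else (\<Sum>k\<in>UNIV. tree_weight T k))" for b
  obtain g where "g \<in> tree_maps j" "0 < map_weight T g"
    using irreducible_tree_map[OF T0 assms(2)] by blast
  then have q: "0 < tree_weight T j"
    unfolding tree_weight_eq using T0 by (intro sum_pos2[of _ g]) (auto intro: map_weight_nonneg)
  have "0 \<le> tree_weight T k" "0 \<le> forest_weight T b k" for b k
    unfolding tree_weight_eq forest_weight_eq using T0 by (auto intro!: sum_nonneg map_weight_nonneg)
  then have H0: "0 \<le> H b" for b by (auto simp: H_def intro!: mult_nonneg_nonneg sum_nonneg)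
  \<comment> \<open>Both cases of the formula obey the same recurrence, so return times need no
    separate treatment afterwards.\<close>
  have numerator: "(if b \<noteq> j then forest_weight T b j else (\<Sum>k\<in>UNIV. tree_weight T k)) =
      tree_weight T j + (\<Sum>c\<in>UNIV. T $ b $ c * forest_weight T c j)" for b
  proof (cases "b = j")
    case True
    then show ?thesis using sum_tree_maps_eq[of T j] by (simp add: tree_weight_eq forest_weight_eq)
  next
    case False
    \<comment> \<open>The row sum 1 turns the left side of the exchange identity into the forest
      weight alone.\<close>
    then show ?thesis using sum_forest_maps_eq[of b j T] T1[of b]
      by (simp add: tree_weight_eq forest_weight_eq flip: sum_distrib_right)
  qed
  \<comment> \<open>This removes the term \<open>c = j\<close>, the only one where
    \<open>H c\<close> is not a quotient of a forest weight.\<close>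
  have "forest_weight T j j = 0" by (simp add: forest_weight_eq forest_maps_self)
  then have "(\<Sum>c\<in>UNIV. T $ b $ c * forest_weight T c j) =
      (\<Sum>c\<in>-{j}. T $ b $ c * forest_weight T c j)" for b
    by (intro sum.mono_neutral_right) auto
  then have "H b = 1 + (\<Sum>c\<in>-{j}. T $ b $ c * H c)" for b
    unfolding H_def numerator[of b] using q
    by (simp add: distrib_left sum_distrib_left mult.left_commute)
  then have "hitting_time M X i j = ennreal (H i)"
    using H0 by (rule hitting_time_eqI[OF assms(3,4)])
  then show ?thesis by (simp add: H_def)
qed

end
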